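(* Let $\xi<\omega_1$. There is no Borel set $S\subseteq 2^\omega\times 2^\omega$ with the following property: for any Polish spaces $X,Y$ and any disjoint analytic subsets $A,B$ of $X\times Y$, exactly one of the following holds: (a) There is a $\mathrm{pot}(\mathbf{\Pi}^0_{1+\xi})$ set $D\subseteq X\times Y$ with $A\subseteq D$ and $D\cap B=\emptyset$. (b) There are continuous maps $u:2^\omega\to X$ and $v:2^\omega\to Y$ with $S\subseteq (u\times v)^{-1}(A)$ and $(2^\omega\times 2^\omega)\setminus S\subseteq (u\times v)^{-1}(B)$.
   Context: A Borel set $A\subseteq X\times Y$ ($X,Y$ Polish) is $\mathrm{pot}(\Gamma)$ if there are Polish topologies $\sigma$ on $X$ and $\tau$ on $Y$, finer than the original ones, with $A\in\Gamma([X,\sigma]\times[Y,\tau])$. *)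

theory Defs
  imports "HOL-Analysis.Analysis"
begin

definition Polish_space :: "'a topology \<Rightarrow> bool" where
  "Polish_space X \<longleftrightarrow> completely_metrizable_space X \<and> separable_space X"

definition borel_sets_of :: "'a topology \<Rightarrow> 'a set set" where
  "borel_sets_of X = sigma_sets (topspace X) {U. openin X U}"

definition Cantor_space :: "(nat \<Rightarrow> bool) topology" where
  "Cantor_space = product_topology (\<lambda>_. discrete_topology UNIV) UNIV"

definition Baire_space :: "(nat \<Rightarrow> nat) topology" where
  "Baire_space = product_topology (\<lambda>_. discrete_topology UNIV) UNIV"

definition analytic_in :: "'a topology \<Rightarrow> 'a set \<Rightarrow> bool" where
  "analytic_in X A \<longleftrightarrow> A \<subseteq> topspace X \<and>
     (A = {} \<or> (\<exists>f. continuous_map Baire_space X f \<and> f ` UNIV = A))"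

text \<open>Additive Borel class Pi^0_{1+xi}, where the countable ordinal xi is the order type
  of a well-order r on a subset of nat.  Pi^0_1 = closed sets; for xi > 0,
  Pi^0_{1+xi} = complements of countable unions of sets in Pi^0_{1+eta}, eta < xi,
  the ordinals eta < xi being the order types of the strict initial segments of r.\<close>
inductive borel_Pi :: "'a topology \<Rightarrow> nat rel \<Rightarrow> 'a set \<Rightarrow> bool" where
  base: "Field r = {} \<Longrightarrow> closedin X D \<Longrightarrow> borel_Pi X r D"
| step: "Field r \<noteq> {} \<Longrightarrow>
           (\<And>n::nat. x n \<in> Field r \<and> borel_Pi X (Restr r (underS r (x n))) (D n)) \<Longrightarrow>
           borel_Pi X r (topspace X - (\<Union>n::nat. D n))"

definition pot_Pi0 :: "'a topology \<Rightarrow> 'b topology \<Rightarrow> nat rel \<Rightarrow> ('a \<times> 'b) set \<Rightarrow> bool" where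
  "pot_Pi0 X Y r D \<longleftrightarrow> D \<in> borel_sets_of (prod_topology X Y) \<and>
     (\<exists>\<sigma> \<tau>. Polish_space \<sigma> \<and> Polish_space \<tau> \<and>
        topspace \<sigma> = topspace X \<and> topspace \<tau> = topspace Y \<and>
        (\<forall>U. openin X U \<longrightarrow> openin \<sigma> U) \<and> (\<forall>U. openin Y U \<longrightarrow> openin \<tau> U) \<and>
        borel_Pi (prod_topology \<sigma> \<tau>) r D)"

end

(*
Let f be a continuous map from the Baire space to a bounded set of reals in which a sum of two elements
determines the summands. The lines y = f z + x fill a set containing no {a, b} x {c, d} with a, b distinct
and c, d distinct. So if A is a union of some of these lines and B the union of the others, and u x v maps
the whole of 2^omega x 2^omega into A Un B, then u or v is constant, and S is a Borel rectangle. Such an S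
is clopen for suitable finer Polish topologies, so the pair (S, complement of S) satisfies both (a) and (b).

It remains to choose the lines so that no pot(Pi^0_{1+xi}) set D separates A from B. Given finer Polish
topologies on the line, there are compact sets K and L of almost full measure on which they agree with the
usual one, so D agrees on K x L with a Pi^0_{1+xi} subset D' of the plane. On a fixed segment of each line,
D' contains most points if the line lies in A and few points if it lies in B, so D' determines the set of
parameters z of the lines in A. Diagonalising over a Borel set
universal for the Pi^0_{1+xi} subsets of the plane gives a Borel set of parameters that no D' induces.
*)

theory Submission
  imports Defs
begin

section \<open>Polish spaces and Borel sets\<close>

text \<open>Balls of radius 1/(n+1) about the points of a countable dense set form a base: if the
  radius is below r/2 and the centre is nearer to x than the radius, the ball contains x and lies in
  the ball of radius r about x.\<close>

lemma separable_metrizable_imp_second_countable: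
  assumes "metrizable_space X" "separable_space X"
  shows "second_countable X"
proof -
  obtain M d where "Metric_space M d" and X: "X = Metric_space.mtopology M d"
    using assms(1) unfolding metrizable_space_def by blast
  then interpret Metric_space M d by simp
  obtain C where C: "countable C" "C \<subseteq> M" "mtopology closure_of C = M"
    using assms(2) X unfolding separable_space_def by auto
  define \<B> where "\<B> = (\<lambda>(c, n). mball c (inverse (real (Suc n)))) ` (C \<times> UNIV)"
  have "\<exists>V\<in>\<B>. x \<in> V \<and> V \<subseteq> U" if U: "openin mtopology U" "x \<in> U" for U x
  proof -
    obtain r where r: "r > 0" "mball x r \<subseteq> U" and xM: "x \<in> M"
      using U openin_mtopology by (metis subsetD)
    obtain n where n: "inverse (real (Suc n)) < r / 2"
      using r(1) reals_Archimedean[of "r/2"] by auto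
    have "x \<in> mtopology closure_of C"
      using C xM by simp
    then obtain c where c: "c \<in> C" "d x c < inverse (real (Suc n))"
      unfolding metric_closure_of using n
      by (smt (verit, best) in_mball inverse_positive_iff_positive mem_Collect_eq of_nat_0_less_iff zero_less_Suc)
    have "mball c (inverse (real (Suc n))) \<subseteq> mball x r"
    proof
      fix y assume y: "y \<in> mball c (inverse (real (Suc n)))"
      then have "d x y \<le> d x c + d c y"
        using triangle xM by (auto simp: in_mball)
      then show "y \<in> mball x r"
        using y c(2) n xM by (auto simp: in_mball)
    qed
    moreover have "x \<in> mball c (inverse (real (Suc n)))"
      using c C xM commute by (auto simp: in_mball)
    ultimately show ?thesis
      using c r unfolding \<B>_def by blast
  qed
  moreover have "countable \<B>"
    unfolding \<B>_def using C by simp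
  moreover have "\<forall>V\<in>\<B>. openin mtopology V"
    unfolding \<B>_def by auto
  ultimately show ?thesis
    unfolding second_countable_def X by blast
qed

text \<open>A basic open set restricts only finitely many coordinates. Hence it suffices to take the
  points that follow dense sequences according to a finite list and continue with the first dense
  point in every later coordinate.\<close>

lemma separable_space_product_nat:
  fixes X :: "nat \<Rightarrow> 'a topology"
  assumes "\<And>i. separable_space (X i)"
  shows "separable_space (product_topology X UNIV)"
proof (cases "\<exists>i. topspace (X i) = {}")
  case True
  then have "topspace (product_topology X UNIV) = {}"
    by (simp add: PiE_eq_empty_iff)
  then show ?thesis
    unfolding separable_space_def by (metis countable_empty closure_of_empty empty_subsetI)
next
  case False
  have "\<exists>a :: nat \<Rightarrow> 'a. range a \<subseteq> topspace (X i) \<and> X i closure_of (range a) = topspace (X i)"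
    for i
  proof -
    obtain C where C: "countable C" "C \<subseteq> topspace (X i)" "X i closure_of C = topspace (X i)"
      using assms[of i] unfolding separable_space_def by auto
    moreover have "C \<noteq> {}"
      using C False by (metis closure_of_empty)
    ultimately have "range (from_nat_into C) = C"
      by simp
    with C show ?thesis
      by (intro exI[of _ "from_nat_into C"] conjI) simp_all
  qed
  then obtain a :: "nat \<Rightarrow> nat \<Rightarrow> 'a" where a: "\<And>i. range (a i) \<subseteq> topspace (X i)"
    "\<And>i. X i closure_of (range (a i)) = topspace (X i)"
    by metis
  define g where "g xs = (\<lambda>i. a i (if i < length xs then xs ! i else 0))" for xs :: "nat list"
  have "x \<in> product_topology X UNIV closure_of (range g)"
    if x: "x \<in> topspace (product_topology X UNIV)" for x
    unfolding in_closure_of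
  proof (intro conjI allI impI)
    fix T assume T: "x \<in> T \<and> openin (product_topology X UNIV) T"
    obtain V where V: "x \<in> (\<Pi>\<^sub>E i\<in>UNIV. V i)" "\<And>i. openin (X i) (V i)"
      "finite {i. V i \<noteq> topspace (X i)}" "(\<Pi>\<^sub>E i\<in>UNIV. V i) \<subseteq> T"
      using product_topology_open_contains_basis[of X UNIV T x] T by blast
    obtain N where N: "\<And>i. V i \<noteq> topspace (X i) \<Longrightarrow> i < N"
      using V(3) unfolding finite_nat_set_iff_bounded by auto
    have "\<exists>k. a i k \<in> V i" for i
    proof -
      have "x i \<in> X i closure_of (range (a i))"
        using a V openin_subset by (metis PiE_mem UNIV_I subsetD)
      then show ?thesis
        using V unfolding in_closure_of by blast
    qed
    then obtain k where k: "\<And>i. a i (k i) \<in> V i"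
      by metis
    have "g (map k [0..<N]) \<in> (\<Pi>\<^sub>E i\<in>UNIV. V i)"
      unfolding g_def using k N a by (auto, metis rangeI subsetD)
    then show "\<exists>y. y \<in> range g \<and> y \<in> T"
      using V by blast
  qed (use x in auto)
  moreover have "range g \<subseteq> topspace (product_topology X UNIV)"
    unfolding g_def using a by auto
  ultimately show ?thesis
    unfolding separable_space_def
    using closure_of_subset_topspace[of "product_topology X UNIV" "range g"]
    by (intro exI[of _ "range g"] conjI subset_antisym subsetI) auto
qed

lemma Polish_space_imp_second_countable: "Polish_space X \<Longrightarrow> second_countable X"
  unfolding Polish_space_def
  by (simp add: completely_metrizable_imp_metrizable_space separable_metrizable_imp_second_countable)

lemma Polish_space_imp_Hausdorff_space: "Polish_space X \<Longrightarrow> Hausdorff_space X"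
  unfolding Polish_space_def
  by (simp add: completely_metrizable_imp_metrizable_space metrizable_imp_Hausdorff_space)

lemma Polish_space_gdelta:
  "Polish_space X \<Longrightarrow> gdelta_in X S \<Longrightarrow> Polish_space (subtopology X S)"
  by (meson Polish_space_def Polish_space_imp_second_countable completely_metrizable_space_gdelta_in
      second_countable_imp_separable_space second_countable_subtopology)

lemma Polish_space_closedin:
  "Polish_space X \<Longrightarrow> closedin X S \<Longrightarrow> Polish_space (subtopology X S)"
  by (meson Polish_space_def Polish_space_imp_second_countable completely_metrizable_space_closedin
      second_countable_imp_separable_space second_countable_subtopology)

lemma homeomorphic_Polish_space:
  "X homeomorphic_space Y \<Longrightarrow> Polish_space X \<longleftrightarrow> Polish_space Y"
  by (simp add: Polish_space_def homeomorphic_completely_metrizable_space homeomorphic_separable_space)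

lemma Polish_space_product_nat:
  fixes X :: "nat \<Rightarrow> 'a topology"
  assumes "\<And>i. Polish_space (X i)"
  shows "Polish_space (product_topology X UNIV)"
  using assms unfolding Polish_space_def
  by (simp add: completely_metrizable_space_product_topology separable_space_product_nat)

lemma Polish_space_euclidean: "Polish_space (euclidean :: 'a::polish_space topology)"
  unfolding Polish_space_def
proof
  show "completely_metrizable_space (euclidean :: 'a topology)"
    by (rule completely_metrizable_space_euclidean)
  obtain D :: "'a set" where D: "countable D" "\<And>X. open X \<Longrightarrow> X \<noteq> {} \<Longrightarrow> \<exists>d\<in>D. d \<in> X"
    using countable_dense_exists by blast
  have "closure D = UNIV"
    using D(2) by (auto simp: closure_iff_nhds_not_empty) blast
  then show "separable_space (euclidean :: 'a topology)"
    unfolding separable_space_def using D(1) by auto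
qed

lemma second_countable_prod_topology:
  assumes "second_countable X" "second_countable Y"
  shows "second_countable (prod_topology X Y)"
proof -
  obtain \<A> where A: "countable \<A>" "\<forall>V\<in>\<A>. openin X V"
    "\<forall>U x. openin X U \<and> x \<in> U \<longrightarrow> (\<exists>V\<in>\<A>. x \<in> V \<and> V \<subseteq> U)"
    using assms(1) unfolding second_countable_def by (elim exE conjE)
  obtain \<B> where B: "countable \<B>" "\<forall>V\<in>\<B>. openin Y V"
    "\<forall>U x. openin Y U \<and> x \<in> U \<longrightarrow> (\<exists>V\<in>\<B>. x \<in> V \<and> V \<subseteq> U)"
    using assms(2) unfolding second_countable_def by (elim exE conjE)
  define \<C> where "\<C> = (\<lambda>(V, W). V \<times> W) ` (\<A> \<times> \<B>)"
  have "\<exists>V\<in>\<C>. z \<in> V \<and> V \<subseteq> U" if U: "openin (prod_topology X Y) U" and z: "z \<in> U" for U z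
  proof -
    obtain x y where xy: "z = (x, y)"
      by (cases z)
    obtain P Q where PQ: "openin X P" "openin Y Q" "x \<in> P" "y \<in> Q" "P \<times> Q \<subseteq> U"
      using U z xy unfolding openin_prod_topology_alt by meson
    obtain V W where "V \<in> \<A>" "x \<in> V" "V \<subseteq> P" "W \<in> \<B>" "y \<in> W" "W \<subseteq> Q"
      using A(3)[rule_format, OF conjI[OF PQ(1,3)]] B(3)[rule_format, OF conjI[OF PQ(2,4)]]
      by (elim bexE conjE)
    then show ?thesis
      using PQ xy unfolding \<C>_def by (intro bexI[of _ "V \<times> W"]) auto
  qed
  moreover have "countable \<C>"
    unfolding \<C>_def using A B by simp
  moreover have "\<forall>V\<in>\<C>. openin (prod_topology X Y) V"
    unfolding \<C>_def using A B by (auto simp: openin_prod_Times_iff)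
  ultimately show ?thesis
    unfolding second_countable_def by blast
qed

lemma Polish_space_prod_topology:
  assumes "Polish_space X" "Polish_space Y"
  shows "Polish_space (prod_topology X Y)"
  using assms unfolding Polish_space_def[of "prod_topology X Y"]
  by (simp add: Polish_space_def completely_metrizable_space_prod_topology Polish_space_imp_second_countable
      second_countable_imp_separable_space second_countable_prod_topology)

lemma Polish_space_discrete_topology: "countable U \<Longrightarrow> Polish_space (discrete_topology U)"
  unfolding Polish_space_def
  by (simp add: completely_metrizable_space_discrete_topology separable_space_discrete_topology)

section \<open>Finer Polish topologies\<close>

text \<open>The injection \<open>i\<close> is a homeomorphism onto a G-delta subspace of
  \<open>Z\<close>. Each finer topology below arises in this way from a suitable
  \<open>Z\<close>.\<close>

lemma Polish_space_pullback:
  assumes "Polish_space Z" "inj_on i T" "gdelta_in Z (i ` T)"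
  shows "Polish_space (pullback_topology T i Z)" "topspace (pullback_topology T i Z) = T"
proof -
  let ?X = "pullback_topology T i Z" and ?Y = "subtopology Z (i ` T)"
  have sub: "i ` T \<subseteq> topspace Z"
    using assms(3) gdelta_in_subset by blast
  then show T: "topspace ?X = T"
    unfolding topspace_pullback_topology by auto
  have "homeomorphic_map ?X ?Y i"
  proof (rule bijective_open_imp_homeomorphic_map)
    have "continuous_map ?X Z (id \<circ> i)"
      by (intro continuous_map_pullback) simp
    then show "continuous_map ?X ?Y i"
      using T by (auto simp: continuous_map_in_subtopology)
    show "open_map ?X ?Y i"
      unfolding open_map_def
    proof (intro allI impI)
      fix W assume "openin ?X W"
      then obtain V where "openin Z V" "W = i -` V \<inter> T"
        unfolding openin_pullback_topology by blast
      then have "openin Z V" "i ` W = V \<inter> i ` T"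
        by auto
      then show "openin ?Y (i ` W)"
        unfolding openin_subtopology by blast
    qed
  qed (use sub T assms in auto)
  then show "Polish_space ?X"
    using homeomorphic_Polish_space Polish_space_gdelta assms homeomorphic_map_imp_homeomorphic_space
    by blast
qed

text \<open>The new topology is that of the graph of the characteristic function of
  \<open>U\<close>. The graph is G-delta, as its part over \<open>True\<close> is open and its part
  over \<open>False\<close> is closed, and the second coordinate makes \<open>U\<close>
  clopen.\<close>

lemma Polish_space_refine_open:
  assumes "Polish_space X" "openin X U"
  shows "\<exists>\<tau>. Polish_space \<tau> \<and> topspace \<tau> = topspace X \<and> (\<forall>W. openin X W \<longrightarrow> openin \<tau> W) \<and>
    openin \<tau> U \<and> closedin \<tau> U"
proof -
  let ?Z = "prod_topology X (discrete_topology (UNIV :: bool set))"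
  let ?i = "\<lambda>x. (x, x \<in> U)" and ?T = "topspace X"
  let ?\<tau> = "pullback_topology ?T ?i ?Z"
  have US: "U \<subseteq> ?T"
    using assms openin_subset by blast
  have Z: "Polish_space ?Z"
    using assms by (intro Polish_space_prod_topology Polish_space_discrete_topology) auto
  have eq: "?i ` ?T = U \<times> {True} \<union> (?T - U) \<times> {False}"
    using US by auto
  have "gdelta_in ?Z (U \<times> {True})"
    using assms by (intro open_imp_gdelta_in) (simp add: openin_prod_Times_iff)
  moreover have "gdelta_in ?Z ((?T - U) \<times> {False})"
    using assms Z by (intro closed_imp_gdelta_in)
      (auto simp: closedin_prod_Times_iff Polish_space_def completely_metrizable_imp_metrizable_space)
  ultimately have g: "gdelta_in ?Z (?i ` ?T)"
    unfolding eq by (rule gdelta_in_Un)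
  have i: "inj_on ?i ?T"
    by (auto simp: inj_on_def)
  note P = Polish_space_pullback[OF Z i g]
  have W: "openin ?\<tau> W" if "openin X W" for W
    unfolding openin_pullback_topology using that openin_subset[OF that]
    by (intro exI[of _ "W \<times> UNIV"]) (auto simp: openin_prod_Times_iff)
  have "openin ?\<tau> (?T - U)"
    unfolding openin_pullback_topology
    by (intro exI[of _ "?T \<times> {False}"]) (auto simp: openin_prod_Times_iff)
  then have "closedin ?\<tau> U"
    using P US by (simp add: closedin_def)
  then show ?thesis
    using P W assms by blast
qed

text \<open>The diagonal of the product of all \<open>\<tau> n\<close> carries a topology finer than
  each of them. It is closed because the coordinates are continuous into the Hausdorff space
  \<open>X\<close>.\<close>

lemma Polish_space_join:
  fixes \<tau> :: "nat \<Rightarrow> 'a topology"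
  assumes X: "Hausdorff_space X"
    and \<tau>: "\<And>n. Polish_space (\<tau> n)" "\<And>n. topspace (\<tau> n) = topspace X"
      "\<And>n W. openin X W \<Longrightarrow> openin (\<tau> n) W"
  shows "\<exists>\<sigma>. Polish_space \<sigma> \<and> topspace \<sigma> = topspace X \<and> (\<forall>n W. openin (\<tau> n) W \<longrightarrow> openin \<sigma> W)"
proof -
  let ?Z = "product_topology \<tau> UNIV" and ?i = "\<lambda>x::'a. \<lambda>n::nat. x" and ?T = "topspace X"
  have Z: "Polish_space ?Z"
    by (intro Polish_space_product_nat \<tau>)
  have c: "continuous_map ?Z X (\<lambda>z. z n)" for n
  proof -
    have "continuous_map (\<tau> n) X id"
      using \<tau>(2,3) topology_finer_continuous_id by metis
    moreover have "continuous_map ?Z (\<tau> n) (\<lambda>z. z n)"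
      by (rule continuous_map_product_projection) simp
    ultimately have "continuous_map ?Z X (id \<circ> (\<lambda>z. z n))"
      by (rule continuous_map_compose[rotated])
    then show ?thesis
      by (simp add: comp_def)
  qed
  have "closedin ?Z (\<Inter>n. {z \<in> topspace ?Z. z n = z 0})"
    by (intro closedin_Inter) (use closedin_continuous_maps_eq[OF X c c] in blast)+
  moreover have "(\<Inter>n. {z \<in> topspace ?Z. z n = z 0}) = ?i ` ?T"
    using \<tau>(2) by (auto simp: fun_eq_iff image_iff PiE_iff) metis
  ultimately have g: "gdelta_in ?Z (?i ` ?T)"
    using Z closed_imp_gdelta_in[of ?Z] by (simp add: completely_metrizable_imp_metrizable_space Polish_space_def)
  have i: "inj_on ?i ?T"
    by (auto simp: inj_on_def fun_eq_iff)
  have "openin (pullback_topology ?T ?i ?Z) W" if W: "openin (\<tau> n) W" for n W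
    unfolding openin_pullback_topology
  proof (intro exI conjI)
    show "openin ?Z {z \<in> topspace ?Z. z n \<in> W}"
      using openin_continuous_map_preimage[OF continuous_map_product_projection[of n UNIV \<tau>] W] by simp
    show "W = ?i -` {z \<in> topspace ?Z. z n \<in> W} \<inter> ?T"
      using openin_subset[OF W] \<tau>(2) by auto
  qed
  then show ?thesis
    using Polish_space_pullback[OF Z i g] by blast
qed

text \<open>Induction over the generated sigma-algebra. For a union, the refinements of the members
  are joined; the union is then open, and one more refinement makes it closed.\<close>

lemma borel_set_clopen_refinement:
  assumes X: "Polish_space X" and C: "C \<in> borel_sets_of X"
  shows "\<exists>\<tau>. Polish_space \<tau> \<and> topspace \<tau> = topspace X \<and> (\<forall>W. openin X W \<longrightarrow> openin \<tau> W) \<and>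
    openin \<tau> C \<and> closedin \<tau> C"
  using C unfolding borel_sets_of_def
proof (induction rule: sigma_sets.induct)
  case (Basic a)
  then show ?case
    using Polish_space_refine_open[OF X] by simp
next
  case Empty
  then show ?case
    using X by (intro exI[of _ X]) auto
next
  case (Compl a)
  then obtain \<tau> where "Polish_space \<tau>" "topspace \<tau> = topspace X" "\<forall>W. openin X W \<longrightarrow> openin \<tau> W"
    "openin \<tau> a" "closedin \<tau> a"
    by (elim exE conjE)
  then show ?case
    using openin_diff[OF openin_topspace[of \<tau>], of a] closedin_diff[OF closedin_topspace[of \<tau>], of a]
    by (intro exI[of _ \<tau>]) simp
next
  case (Union a)
  have "\<forall>n. \<exists>\<tau>. Polish_space \<tau> \<and> topspace \<tau> = topspace X \<and> (\<forall>W. openin X W \<longrightarrow> openin \<tau> W) \<and>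
    openin \<tau> (a n) \<and> closedin \<tau> (a n)"
    by (rule allI) (rule Union.IH)
  from choice[OF this] obtain \<tau> where \<tau>: "\<And>n. Polish_space (\<tau> n)"
    "\<And>n. topspace (\<tau> n) = topspace X" "\<And>n W. openin X W \<Longrightarrow> openin (\<tau> n) W"
    "\<And>n. openin (\<tau> n) (a n)"
    by auto
  from Polish_space_join[of X \<tau>, OF Polish_space_imp_Hausdorff_space[OF X] \<tau>(1-3)]
  obtain \<sigma> where \<sigma>: "Polish_space \<sigma>" "topspace \<sigma> = topspace X"
    "\<And>n W. openin (\<tau> n) W \<Longrightarrow> openin \<sigma> W"
    by auto
  have "openin \<sigma> (\<Union>n. a n)"
    using \<tau>(4) \<sigma>(3) by (intro openin_Union) auto
  from Polish_space_refine_open[OF \<sigma>(1) this] obtain \<rho> where "Polish_space \<rho>"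
    "topspace \<rho> = topspace \<sigma>" "\<And>W. openin \<sigma> W \<Longrightarrow> openin \<rho> W"
    "openin \<rho> (\<Union>n. a n)" "closedin \<rho> (\<Union>n. a n)"
    by auto
  then show ?case
    using \<sigma>(2,3) \<tau>(3) by (intro exI[of _ \<rho>]) simp
qed

section \<open>Baire space and analytic sets\<close>

lemma discrete_topology_UNIV_eq_euclidean: "discrete_topology UNIV = (euclidean :: 'a::discrete_topology topology)"
  by (simp add: topology_eq open_discrete)

lemma Baire_space_eq_euclidean: "Baire_space = euclidean"
  unfolding Baire_space_def discrete_topology_UNIV_eq_euclidean by (rule euclidean_product_topology)

lemma Cantor_space_eq_euclidean: "Cantor_space = euclidean"
  unfolding Cantor_space_def discrete_topology_UNIV_eq_euclidean by (rule euclidean_product_topology)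

lemma open_Baire_prefix: "open {w :: nat \<Rightarrow> nat. \<forall>i<n. w i = z i}"
proof -
  have "{w :: nat \<Rightarrow> nat. \<forall>i<n. w i = z i} = (\<Inter>i\<in>{..<n}. (\<lambda>w. w i) -` {z i})"
    by auto
  also have "open \<dots>"
    by (intro open_INT ballI open_vimage) (auto simp: open_discrete intro: continuous_on_product_coordinates)
  finally show ?thesis .
qed

lemma open_Baire_prefixE:
  assumes "open U" "(z :: nat \<Rightarrow> nat) \<in> U"
  obtains n where "\<And>w. (\<And>i. i < n \<Longrightarrow> w i = z i) \<Longrightarrow> w \<in> U"
proof -
  obtain X where X: "z \<in> Pi\<^sub>E UNIV X" "finite {i. X i \<noteq> UNIV}" "Pi\<^sub>E UNIV X \<subseteq> U"
    using product_topology_open_contains_basis[of "\<lambda>_. euclidean" UNIV U z] assms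
    unfolding open_fun_def by auto
  obtain n where n: "\<And>i. X i \<noteq> UNIV \<Longrightarrow> i < n"
    using X(2) unfolding finite_nat_set_iff_bounded by auto
  have "w \<in> U" if "\<And>i. i < n \<Longrightarrow> w i = z i" for w
  proof -
    have "w i \<in> X i" for i
      using n[of i] that[of i] X(1) by (cases "X i = UNIV") (auto simp: PiE_iff)
    then show ?thesis
      using X(3) by (auto simp: PiE_iff)
  qed
  then show thesis
    using that by blast
qed

text \<open>A sequence \<open>z\<close> names points of a countable dense set; \<open>f z\<close> is
  the limit of the sequence \<open>y z\<close> that follows these names as long as the jumps are
  short.\<close>

lemma Polish_space_image_Baire_space:
  assumes X: "Polish_space X" and ne: "topspace X \<noteq> {}"
  shows "\<exists>f. continuous_map Baire_space X f \<and> f ` UNIV = topspace X"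
proof -
  obtain M d where "Metric_space M d" and complete: "Metric_space.mcomplete M d"
    and Xeq: "X = Metric_space.mtopology M d"
    using X unfolding Polish_space_def completely_metrizable_space_def by blast
  then interpret Metric_space M d by simp
  obtain C where C: "countable C" "C \<subseteq> M" "mtopology closure_of C = M"
    using X unfolding Xeq Polish_space_def separable_space_def by auto
  have "C \<noteq> {}"
    using C ne Xeq by auto
  define a where "a = from_nat_into C"
  have ran: "range a = C"
    unfolding a_def using C(1) \<open>C \<noteq> {}\<close> by simp
  have aM: "a i \<in> M" for i
    using ran C(2) by auto
  have dense: "\<exists>i. d x (a i) < r" if "x \<in> M" "r > 0" for x r
  proof -
    have "x \<in> mtopology closure_of C"
      using C that by simp
    then have "\<exists>y\<in>C. y \<in> mball x r"
      unfolding metric_closure_of using that(2) by simp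
    then show ?thesis
      using ran by auto
  qed
  \<comment> \<open>A jump of length at least (1/2)^n is refused, so that \<open>y z\<close> is
    Cauchy for every \<open>z\<close> and \<open>f\<close> is defined on the whole Baire
    space.\<close>
  define y where "y z = rec_nat (a (z 0))
      (\<lambda>n p. if d p (a (z (Suc n))) < (1/2)^n then a (z (Suc n)) else p)" for z :: "nat \<Rightarrow> nat"
  have y0: "y z 0 = a (z 0)"
    and ySuc: "y z (Suc n) = (if d (y z n) (a (z (Suc n))) < (1/2)^n then a (z (Suc n)) else y z n)"
    for z n
    unfolding y_def by simp_all
  have yM: "y z n \<in> M" for z n
    by (induction n) (auto simp: y0 ySuc aM)
  have step: "d (y z n) (y z (Suc n)) \<le> (1/2)^n" for z n
    using yM[of z n] by (auto simp: ySuc)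
  \<comment> \<open>The exact value of the finite geometric sum is kept, since the bound without the
    subtracted term would not pass through the induction.\<close>
  have tail: "d (y z n) (y z (n + k)) \<le> 2 * (1/2)^n - 2 * (1/2)^(n+k)" for z n k
  proof (induction k)
    case 0
    then show ?case
      using yM by simp
  next
    case (Suc k)
    have "d (y z n) (y z (n + Suc k)) \<le> d (y z n) (y z (n + k)) + d (y z (n + k)) (y z (Suc (n + k)))"
      using triangle yM by simp
    also have "\<dots> \<le> 2 * (1/2)^n - 2 * (1/2)^(n+k) + (1/2)^(n+k)"
      using Suc step by (intro add_mono) auto
    finally show ?case
      by simp
  qed
  have tail': "d (y z n) (y z (n + k)) \<le> 2 * (1/2)^n" for z n k
    by (rule order_trans[OF tail]) simp
  have small: "\<exists>n. 2 * (1/2)^n < e" if "e > (0::real)" for e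
  proof -
    have "\<exists>n. (1/2)^n < e/2"
      by (rule real_arch_pow_inv) (use that in auto)
    then obtain n where "(1/2)^n < e/2"
      by (elim exE)
    then show ?thesis
      by (intro exI[of _ n]) linarith
  qed
  have "\<exists>l. limitin mtopology (y z) l sequentially" for z
  proof -
    have "MCauchy (y z)"
      unfolding MCauchy_def
    proof (intro conjI allI impI)
      fix e :: real assume "e > 0"
      then obtain n where n: "2 * (1/2)^n < e/2"
        using small[OF half_gt_zero[OF \<open>e > 0\<close>]] by blast
      show "\<exists>N. \<forall>n n'. N \<le> n \<longrightarrow> N \<le> n' \<longrightarrow> d (y z n) (y z n') < e"
      proof (intro exI allI impI)
        fix p q assume "n \<le> p" "n \<le> q"
        then have "d (y z n) (y z p) < e/2" "d (y z n) (y z q) < e/2"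
          using tail'[of z n "p - n"] tail'[of z n "q - n"] n by auto
        moreover have "d (y z p) (y z q) \<le> d (y z n) (y z p) + d (y z n) (y z q)"
          using triangle[of "y z p" "y z n" "y z q"] yM by (simp add: commute)
        ultimately show "d (y z p) (y z q) < e"
          by linarith
      qed
    qed (use yM in auto)
    then show ?thesis
      using complete unfolding mcomplete_def by blast
  qed
  then have "\<forall>z. \<exists>l. limitin mtopology (y z) l sequentially"
    by blast
  from choice[OF this] obtain f where f: "\<And>z. limitin mtopology (y z) (f z) sequentially"
    by blast
  have fM: "f z \<in> M" for z
    using f[of z] limitin_mspace by blast
  have fd: "d (y z n) (f z) \<le> 2 * (1/2)^n" for z n
  proof (rule field_le_epsilon)
    fix e :: real assume "e > 0"
    then have "\<forall>\<^sub>F k in sequentially. y z k \<in> M \<and> d (y z k) (f z) < e"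
      using f[of z] unfolding limitin_metric by blast
    then obtain k0 where k0: "\<And>k. k \<ge> k0 \<Longrightarrow> d (y z k) (f z) < e"
      unfolding eventually_sequentially by blast
    define k where "k = max n k0"
    have "k \<ge> n" "d (y z k) (f z) < e"
      unfolding k_def using k0 by auto
    moreover have "d (y z n) (f z) \<le> d (y z n) (y z k) + d (y z k) (f z)"
      using triangle yM fM by simp
    ultimately show "d (y z n) (f z) \<le> 2 * (1/2)^n + e"
      using tail'[of z n "k - n"] by simp
  qed
  have cong: "y w n = y z n" if "\<And>i. i \<le> n \<Longrightarrow> w i = z i" for w z n
    using that by (induction n) (auto simp: y0 ySuc)
  have cont: "continuous_map euclidean mtopology f"
    unfolding continuous_map_to_metric
  proof (intro ballI allI impI)
    fix z :: "nat \<Rightarrow> nat" and e :: real assume "e > 0"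
    then obtain n where n: "2 * (1/2)^n < e/2"
      using small[OF half_gt_zero[OF \<open>e > 0\<close>]] by blast
    \<comment> \<open>\<open>y w n\<close> reads the entries from 0 to \<open>n\<close>, hence a
      prefix of length \<open>Suc n\<close>.\<close>
    have "f w \<in> mball (f z) e" if "\<forall>i<Suc n. w i = z i" for w
    proof -
      have "y w n = y z n"
        by (rule cong) (use that in simp)
      then have "d (f z) (f w) \<le> d (y z n) (f z) + d (y w n) (f w)"
        using triangle[of "f z" "y z n" "f w"] yM fM by (simp add: commute)
      then show ?thesis
        using fd[of z n] fd[of w n] n fM by auto
    qed
    then show "\<exists>U. openin euclidean U \<and> z \<in> U \<and> (\<forall>w\<in>U. f w \<in> mball (f z) e)"
      using open_Baire_prefix[of "Suc n" z] by (intro exI[of _ "{w. \<forall>i<Suc n. w i = z i}"]) auto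
  qed
  have "x \<in> range f" if x: "x \<in> M" for x
  proof -
    have "\<exists>i. d x (a i) < (1/2)^n / 4" for n :: nat
      by (rule dense[OF x]) simp
    then have "\<forall>n. \<exists>i. d x (a i) < (1/2)^n / 4"
      by blast
    from choice[OF this] obtain z where z: "\<And>n. d x (a (z n)) < (1/2)^n / 4"
      by blast
    \<comment> \<open>No jump is refused: a quarter and an eighth of (1/2)^n add up to less than
      (1/2)^n.\<close>
    have "y z n = a (z n)" for n
    proof (induction n)
      case (Suc n)
      have "d (a (z n)) (a (z (Suc n))) \<le> d x (a (z n)) + d x (a (z (Suc n)))"
        using triangle[of "a (z n)" x "a (z (Suc n))"] aM x by (simp add: commute)
      also have "\<dots> < (1/2)^n / 4 + (1/2)^(Suc n) / 4"
        using z by (intro add_strict_mono)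
      also have "\<dots> \<le> (1/2)^n"
        by simp
      finally show ?case
        using Suc by (simp add: ySuc)
    qed (simp add: y0)
    have "d x (f z) \<le> e" if "e > 0" for e
    proof -
      obtain n where n: "2 * (1/2)^n < e/2"
        using small[OF half_gt_zero[OF \<open>e > 0\<close>]] by blast
      have "d x (f z) \<le> d x (y z n) + d (y z n) (f z)"
        using triangle x yM fM by simp
      also have "\<dots> \<le> (1/2)^n / 4 + 2 * (1/2)^n"
        using z[of n] fd[of z n] \<open>y z n = a (z n)\<close> by (intro add_mono) simp_all
      also have "\<dots> \<le> 2 * (2 * (1/2)^n)"
        by simp
      finally show ?thesis
        using n by linarith
    qed
    then have "d x (f z) \<le> 0"
      using field_le_epsilon[of "d x (f z)" 0] by simp
    then show ?thesis
      using x fM[of z] nonneg[of x "f z"] zero[of x "f z"] by (metis order_antisym rangeI)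
  qed
  then have "range f = M"
    using fM by auto
  then show ?thesis
    using cont Xeq Baire_space_eq_euclidean by (intro exI[of _ f]) simp
qed

text \<open>In a finer Polish topology \<open>C\<close> is closed, so it is a Polish subspace and an
  image of the Baire space. The map remains continuous into the coarser topology.\<close>

lemma borel_imp_analytic_in:
  assumes X: "Polish_space X" and C: "C \<in> borel_sets_of X"
  shows "analytic_in X C"
proof (cases "C = {}")
  case False
  obtain \<tau> where \<tau>: "Polish_space \<tau>" "topspace \<tau> = topspace X" "\<And>W. openin X W \<Longrightarrow> openin \<tau> W"
    "closedin \<tau> C"
    using borel_set_clopen_refinement[OF X C] by auto
  have sub: "C \<subseteq> topspace X"
    using closedin_subset[OF \<tau>(4)] \<tau>(2) by simp
  then have "topspace (subtopology \<tau> C) = C"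
    using \<tau>(2) by auto
  then obtain f where f: "continuous_map Baire_space (subtopology \<tau> C) f" "f ` UNIV = C"
    using Polish_space_image_Baire_space[OF Polish_space_closedin[OF \<tau>(1,4)]] False by auto
  have "continuous_map \<tau> X id"
    using \<tau>(2,3) topology_finer_continuous_id by metis
  then have "continuous_map Baire_space X (id \<circ> f)"
    using f(1) by (intro continuous_map_compose[of Baire_space \<tau>]) (auto simp: continuous_map_in_subtopology)
  then show ?thesis
    unfolding analytic_in_def using sub f(2) by auto
qed (simp add: analytic_in_def)

lemma analytic_in_continuous_image:
  assumes "analytic_in X A" "continuous_map X Y h"
  shows "analytic_in Y (h ` A)"
proof (cases "A = {}")
  case False
  then obtain f where f: "continuous_map Baire_space X f" "f ` UNIV = A"
    using assms unfolding analytic_in_def by auto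
  have "continuous_map Baire_space Y (h \<circ> f)"
    using continuous_map_compose f(1) assms(2) by blast
  moreover have "(h \<circ> f) ` UNIV = h ` A"
    using f(2) by (metis image_comp)
  moreover have "h ` A \<subseteq> topspace Y"
    using assms continuous_map_image_subset_topspace unfolding analytic_in_def by blast
  ultimately show ?thesis
    unfolding analytic_in_def by blast
qed (simp add: analytic_in_def)

section \<open>Inner approximation by compact sets of a finer Polish topology\<close>

lemma compact_box_Baire: "compact {z :: nat \<Rightarrow> nat. \<forall>i. z i \<le> k i}"
proof -
  have "compactin (product_topology (\<lambda>i::nat. euclidean :: nat topology) UNIV) (\<Pi>\<^sub>E i\<in>UNIV. {..k i})"
    by (simp add: compactin_PiE finite_imp_compact)
  moreover have "(\<Pi>\<^sub>E i\<in>UNIV. {..k i}) = {z. \<forall>i. z i \<le> k i}"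
    by (auto simp: PiE_iff)
  ultimately show ?thesis
    by (simp add: euclidean_product_topology)
qed

text \<open>The trick is to truncate: a point bounded by \<open>k\<close> on its first \<open>n\<close> coordinates agrees there with
  its coordinatewise minimum with \<open>k\<close>, which lies in the compact box.\<close>

lemma open_superset_box_Baire:
  assumes V: "open V" and sub: "{z :: nat \<Rightarrow> nat. \<forall>i. z i \<le> k i} \<subseteq> V"
  obtains n where "{z. \<forall>i<n. z i \<le> k i} \<subseteq> V"
proof -
  let ?W = "{z :: nat \<Rightarrow> nat. \<forall>i. z i \<le> k i}"
  have "\<forall>w\<in>?W. \<exists>n. \<forall>z. (\<forall>i<n. z i = w i) \<longrightarrow> z \<in> V"
  proof
    fix w assume "w \<in> ?W"
    then have "w \<in> V"
      using sub by blast
    then obtain n where "\<And>z. (\<And>i. i < n \<Longrightarrow> z i = w i) \<Longrightarrow> z \<in> V"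
      using open_Baire_prefixE[OF V] by blast
    then show "\<exists>n. \<forall>z. (\<forall>i<n. z i = w i) \<longrightarrow> z \<in> V"
      by blast
  qed
  from bchoice[OF this] obtain N where N: "\<And>w z. w \<in> ?W \<Longrightarrow> (\<forall>i<N w. z i = w i) \<Longrightarrow> z \<in> V"
    by blast
  obtain C where C: "C \<subseteq> ?W" "finite C" "?W \<subseteq> (\<Union>w\<in>C. {z. \<forall>i<N w. z i = w i})"
  proof (rule compactE_image[OF compact_box_Baire])
    show "open {z. \<forall>i<N w. z i = w i}" for w
      by (rule open_Baire_prefix)
    show "?W \<subseteq> (\<Union>w\<in>?W. {z. \<forall>i<N w. z i = w i})"
      by blast
  qed blast
  obtain n where n: "\<And>w. w \<in> C \<Longrightarrow> N w \<le> n"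
    using finite_nat_set_iff_bounded_le[of "N ` C"] C(2) by auto
  have "z \<in> V" if z: "\<forall>i<n. z i \<le> k i" for z
  proof -
    have "(\<lambda>i. min (z i) (k i)) \<in> ?W"
      by simp
    from subsetD[OF C(3) this] obtain w where w: "w \<in> C" "\<forall>i<N w. min (z i) (k i) = w i"
      by auto
    have "\<forall>i<N w. z i = w i"
    proof (intro allI impI)
      fix i assume i: "i < N w"
      then have "z i \<le> k i"
        using z n[OF w(1)] by simp
      then show "z i = w i"
        using w(2)[rule_format, OF i] by simp
    qed
    then show ?thesis
      using N w(1) C(1) by blast
  qed
  then show thesis
    using that by blast
qed

lemma closedin_of_finer:
  assumes "topspace \<tau> = UNIV" "\<And>U. open U \<Longrightarrow> openin \<tau> U" "closed C"
  shows "closedin \<tau> C"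
  using assms unfolding closedin_def closed_def by (simp add: Compl_eq_Diff_UNIV)

text \<open>Choquet's capacitability argument, applied to the identity from \<open>\<tau>\<close> to the usual topology. It
  replaces the theorem of Lusin and Souslin that \<open>\<tau>\<close>-open sets are Borel.\<close>

lemma compactin_inner_approx:
  fixes \<tau> :: "real topology" and a b e :: real
  assumes \<tau>: "Polish_space \<tau>" "topspace \<tau> = UNIV" "\<And>U. open U \<Longrightarrow> openin \<tau> U"
    and "a < b" "e > 0"
  shows "\<exists>K. compactin \<tau> K \<and> compact K \<and> K \<subseteq> {a..b} \<and> measure lborel ({a..b} - K) < e"
proof -
  let ?m = "outer_measure_of (lborel :: real measure)"
  let ?I = "{a..b}"
  have "\<exists>f. continuous_map Baire_space \<tau> f \<and> range f = topspace \<tau>"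
    by (rule Polish_space_image_Baire_space[OF \<tau>(1)]) (simp add: \<tau>(2) flip: null_topspace_iff_trivial)
  then obtain f :: "(nat \<Rightarrow> nat) \<Rightarrow> real" where f: "continuous_map euclidean \<tau> f" "range f = UNIV"
    unfolding \<tau>(2) Baire_space_eq_euclidean by blast
  \<comment> \<open>These sets are not shown to be Borel, so their size is taken in outer
    measure.\<close>
  define F where "F n k = f ` {z. \<forall>i<n. z i \<le> k i} \<inter> ?I" for n k
  \<comment> \<open>One half of \<open>e\<close> is spent here, the other half on the open set
    \<open>U\<close> around \<open>K\<close>.\<close>
  define c where "c = ennreal (b - a - e / 2)"
  have "\<exists>s. \<forall>n. c < ?m (F n (s n)) \<and> (\<exists>j. s (Suc n) = (s n)(n := j))"
  proof (rule dependent_nat_choice)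
    have "F 0 (\<lambda>_. 0) = ?I"
      unfolding F_def using f(2) by simp
    then have "?m (F 0 (\<lambda>_. 0)) = ennreal (b - a)"
      using \<open>a < b\<close> by simp
    moreover have "c < ennreal (b - a)"
      unfolding c_def using \<open>a < b\<close> \<open>e > 0\<close> by (intro ennreal_lessI) auto
    ultimately show "\<exists>s. c < ?m (F 0 s)"
      by (intro exI[of _ "\<lambda>_. 0"]) simp
  next
    fix s n assume s: "c < ?m (F n s)"
    have eq: "(\<forall>i<Suc n. z i \<le> (s(n := j)) i) \<longleftrightarrow> (\<forall>i<n. z i \<le> s i) \<and> z n \<le> j" for z :: "nat \<Rightarrow> nat" and j
      by (auto simp: less_Suc_eq)
    \<comment> \<open>Outer measure is continuous along increasing sequences of arbitrary sets, so
      some bound \<open>j\<close> on coordinate \<open>n\<close> keeps it above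
      \<open>c\<close>.\<close>
    have "F n s = (\<Union>j. F (Suc n) (s(n := j)))"
      unfolding F_def eq by auto
    moreover have "incseq (\<lambda>j. F (Suc n) (s(n := j)))"
      unfolding F_def eq incseq_def by force
    ultimately have "?m (F n s) = (SUP j. ?m (F (Suc n) (s(n := j))))"
      using SUP_outer_measure_of_incseq[of "\<lambda>j. F (Suc n) (s(n := j))" lborel] by simp
    then obtain j where "c < ?m (F (Suc n) (s(n := j)))"
      using s by (auto simp: less_SUP_iff)
    then show "\<exists>t. c < ?m (F (Suc n) t) \<and> (\<exists>j. t = s(n := j))"
      by blast
  qed
  then obtain s where s: "\<And>n. c < ?m (F n (s n))" and step: "\<And>n. \<exists>j. s (Suc n) = (s n)(n := j)"
    by blast
  \<comment> \<open>Coordinate \<open>i\<close> is bounded at stage \<open>Suc i\<close> and left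
    alone afterwards, so the bounds \<open>s n\<close> stabilise to \<open>k\<close>.\<close>
  define k where "k i = s (Suc i) i" for i
  have k: "s n i = k i" if "i < n" for n i
    using that
  proof (induction n)
    case (Suc n)
    then show ?case
      using step[of n] by (cases "i = n") (auto simp: k_def)
  qed simp
  have Fk: "F n (s n) = F n k" for n
    unfolding F_def using k by (intro arg_cong2[of _ _ _ _ "(\<inter>)"] arg_cong2[of _ _ _ _ "(`)"]) auto
  let ?W = "{z. \<forall>i. z i \<le> k i}"
  define K where "K = f ` ?W \<inter> ?I"
  have "compactin \<tau> (f ` ?W)"
    using image_compactin[OF _ f(1)] compact_box_Baire by simp
  then have K\<tau>: "compactin \<tau> K"
    unfolding K_def using closedin_of_finer[OF \<tau>(2,3), of ?I]
    by (simp add: compact_Int_closedin)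
  have "continuous_map \<tau> euclidean id"
    using \<tau>(2,3) topology_finer_continuous_id[of euclidean \<tau>] by simp
  then have K: "compact K"
    using image_compactin[OF K\<tau>] by fastforce
  have KI: "K \<subseteq> ?I"
    unfolding K_def by simp
  have KB: "K \<in> sets borel"
    using K by (rule borel_compact)
  have fin: "emeasure lborel K < \<infinity>"
    using emeasure_bounded_finite[of K] compact_imp_bounded[OF K] by simp
  obtain U where U: "open U" "K \<subseteq> U" "emeasure lborel (U - K) < ennreal (e / 2)"
    using outer_regular_lborel[OF KB, of "e / 2"] \<open>e > 0\<close> by auto
  \<comment> \<open>\<open>f\<close> may send points of the box outside the interval; with the
    complement of \<open>?I\<close> added, the open set contains the image of the whole box.\<close>
  have "open (U \<union> - ?I)"
    using U(1) by (intro open_Un open_Compl closed_atLeastAtMost)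
  moreover have "open (f -` V)" if "open V" for V
    using openin_continuous_map_preimage[OF f(1) \<tau>(3)[OF that]] by (simp add: vimage_def)
  ultimately have "open (f -` (U \<union> - ?I))"
    by blast
  moreover have "?W \<subseteq> f -` (U \<union> - ?I)"
    using U(2) unfolding K_def by blast
  ultimately obtain n where n: "{z. \<forall>i<n. z i \<le> k i} \<subseteq> f -` (U \<union> - ?I)"
    by (rule open_superset_box_Baire)
  have "F n k \<subseteq> U"
    using n unfolding F_def by blast
  then have "c < emeasure lborel U"
    using s[of n] outer_measure_of_mono[of "F n k" U lborel] U(1) by (simp add: Fk)
  also have "emeasure lborel U = emeasure lborel K + emeasure lborel (U - K)"
    using KB U(1,2) by (subst plus_emeasure) (auto simp: Un_absorb1)
  also have "\<dots> \<le> ennreal (measure lborel K) + ennreal (e / 2)"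
    using U(3) fin by (intro add_mono) (auto simp: emeasure_eq_ennreal_measure)
  also have "\<dots> = ennreal (measure lborel K + e / 2)"
    using \<open>e > 0\<close> by simp
  finally have "ennreal (b - a - e / 2) < ennreal (measure lborel K + e / 2)"
    unfolding c_def .
  then have "b - a - e / 2 < measure lborel K + e / 2"
    by (metis ennreal_leI not_less)
  moreover have "measure lborel (?I - K) = measure lborel ?I - measure lborel K"
    using KB KI \<open>a < b\<close> by (intro measure_Diff) auto
  ultimately have "measure lborel (?I - K) < e"
    using \<open>a < b\<close> by simp
  then show ?thesis
    using K\<tau> K KI by blast
qed

section \<open>The Borel hierarchy\<close>

text \<open>Closed sets of a subspace are the traces of closed sets, and complements and countable
  unions commute with traces. This moves a set from finer topologies to the usual plane where the
  two agree.\<close>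

lemma borel_Pi_transfer:
  assumes "borel_Pi X r D" and eq: "subtopology X T = subtopology Y T"
  shows "\<exists>D'. borel_Pi Y r D' \<and> D' \<inter> T = D \<inter> T"
  using assms
proof (induction rule: borel_Pi.induct)
  case (base r X D)
  then have "closedin (subtopology Y T) (D \<inter> T)"
    using closedin_subtopology by metis
  then obtain D' where "closedin Y D'" "D \<inter> T = D' \<inter> T"
    unfolding closedin_subtopology by auto
  then show ?case
    using borel_Pi.base[OF base(1)] by blast
next
  case (step r x X D)
  have "\<forall>n. \<exists>D'. borel_Pi Y (Restr r (underS r (x n))) D' \<and> D' \<inter> T = D n \<inter> T"
    using step by blast
  from choice[OF this] obtain D' where D': "\<And>n. borel_Pi Y (Restr r (underS r (x n))) (D' n)"
    "\<And>n. D' n \<inter> T = D n \<inter> T"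
    by blast
  have "borel_Pi Y r (topspace Y - (\<Union>n. D' n))"
    using step.hyps step.IH D'(1) by (intro borel_Pi.step[where x = x]) blast+
  moreover have "topspace Y \<inter> T = topspace X \<inter> T"
    using step.prems topspace_subtopology by metis
  then have "(topspace Y - (\<Union>n. D' n)) \<inter> T = (topspace X - (\<Union>n. D n)) \<inter> T"
    using D'(2) by blast
  ultimately show ?case
    by blast
qed

text \<open>The least element of a nonempty \<open>r\<close> has no predecessors, so its level
  consists of the closed sets. The clopen set is the complement of a constant union of one such
  set.\<close>

lemma borel_Pi_clopen:
  assumes r: "Well_order r" and D: "closedin X D" "openin X D"
  shows "borel_Pi X r D"
proof (cases "Field r = {}")
  case True
  then show ?thesis
    using D by (simp add: borel_Pi.base)
next
  case False
  have wo: "wo_rel r"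
    using r by (simp add: wo_rel_def)
  obtain m where m: "m \<in> Field r" "\<And>k. k \<in> Field r \<Longrightarrow> (m, k) \<in> r"
    using wo_rel.minim_in[OF wo, of "Field r"] wo_rel.minim_least[OF wo, of "Field r"] False by blast
  then have "underS r m = {}"
    using wo_rel.ANTISYM[OF wo] unfolding underS_def by (auto intro: FieldI1 dest: antisymD)
  have "borel_Pi X r (topspace X - (\<Union>n::nat. topspace X - D))"
    using False m(1) \<open>underS r m = {}\<close> D
    by (intro borel_Pi.step[where x = "\<lambda>_. m"]) (auto intro!: borel_Pi.base)
  moreover have "topspace X - (\<Union>n::nat. topspace X - D) = D"
    using D openin_subset by fastforce
  ultimately show ?thesis
    by simp
qed

section \<open>Universal Borel sets\<close>

text \<open>A code lists basic open sets, and its section is the complement of their union.\<close>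

lemma closed_universal:
  "\<exists>U \<in> sets (borel :: ((nat \<Rightarrow> nat) \<times> 'a::second_countable_topology) measure).
     \<forall>D. closed D \<longrightarrow> (\<exists>w. D = {p. (w, p) \<in> U})"
proof -
  obtain \<B> :: "'a set set" where \<B>: "countable \<B>" "topological_basis \<B>"
    using ex_countable_basis by auto
  \<comment> \<open>The empty set is added so that every subfamily of the base, even the empty one,
    can be listed by an infinite sequence.\<close>
  define B where "B = from_nat_into (insert {} \<B>)"
  have ran: "range B = insert {} \<B>"
    unfolding B_def using \<B>(1) by (intro range_from_nat_into) auto
  have open_B: "open (B k)" for k
    using ran \<B>(2) topological_basis_open by (metis insertE open_empty rangeI)
  define U where "U = {(w :: nat \<Rightarrow> nat, p). \<forall>n. p \<notin> B (w n)}"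
  have "- U = (\<Union>n. \<Union>k. ((\<lambda>w. w n) -` {k}) \<times> B k)"
    unfolding U_def by auto
  also have "open \<dots>"
    by (intro open_UN ballI open_Times open_B open_vimage)
      (auto simp: open_discrete intro: continuous_on_product_coordinates)
  finally have "U \<in> sets borel"
    using closed_def borel_closed by blast
  moreover have "\<exists>w. D = {p. (w, p) \<in> U}" if "closed D" for D
  proof -
    obtain \<S> where \<S>: "\<S> \<subseteq> \<B>" "\<Union>\<S> = - D"
      using \<B>(2) \<open>closed D\<close> unfolding topological_basis_def closed_def by blast
    have "countable (insert {} \<S>)"
      using countable_subset[OF \<S>(1) \<B>(1)] by simp
    then have S: "range (from_nat_into (insert {} \<S>)) = insert {} \<S>"
      by (intro range_from_nat_into) auto
    have "\<forall>n. \<exists>k. B k = from_nat_into (insert {} \<S>) n"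
    proof
      fix n
      have "from_nat_into (insert {} \<S>) n \<in> insert {} \<B>"
        using S \<S>(1) by (metis insert_mono rangeI subsetD)
      then show "\<exists>k. B k = from_nat_into (insert {} \<S>) n"
        using ran by (metis rangeE)
    qed
    from choice[OF this] obtain w where w: "\<And>n. B (w n) = from_nat_into (insert {} \<S>) n"
      by blast
    have "(\<Union>n. B (w n)) = \<Union>(insert {} \<S>)"
      unfolding w using S by simp
    then have "- D = (\<Union>n. B (w n))"
      using \<S>(2) by simp
    then have "D = {p. (w, p) \<in> U}"
      unfolding U_def by auto
    then show ?thesis
      by blast
  qed
  ultimately show ?thesis
    by blast
qed

text \<open>In the induction step a code \<open>w\<close> is split into countably many sequences; the first entry of the \<open>n\<close>-th
  one names the level of \<open>r\<close> from which the \<open>n\<close>-th set is taken, and the rest is a code for that set.\<close>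

lemma borel_Pi_universal:
  assumes "Well_order r"
  shows "\<exists>U \<in> sets (borel :: ((nat \<Rightarrow> nat) \<times> 'a::second_countable_topology) measure).
     \<forall>D. borel_Pi euclidean r D \<longrightarrow> (\<exists>w. D = {p. (w, p) \<in> U})"
  using assms
\<comment> \<open>Restrictions of \<open>r\<close> to strict initial segments are smaller for
  \<open>ordLess\<close>, which matches the recursion of \<open>borel_Pi\<close>.\<close>
proof (induction r rule: wf_induct[OF wf_ordLess])
  case (1 r)
  show ?case
  proof (cases "Field r = {}")
    case True
    have "closed D" if "borel_Pi euclidean r D" for D :: "'a set"
      using that by (cases rule: borel_Pi.cases) (auto simp: True)
    then show ?thesis
      using closed_universal[where 'a = 'a] by blast
  next
    case False
    have "\<forall>k\<in>Field r. \<exists>U. U \<in> sets (borel :: ((nat \<Rightarrow> nat) \<times> 'a) measure) \<and>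
       (\<forall>D. borel_Pi euclidean (Restr r (underS r k)) D \<longrightarrow> (\<exists>w. D = {p. (w, p) \<in> U}))"
    proof
      fix k assume "k \<in> Field r"
      then have "(Restr r (underS r k), r) \<in> ordLess"
        using underS_Restr_ordLess[OF 1(2) False] by blast
      moreover have "Well_order (Restr r (underS r k))"
        using 1(2) by (rule Well_order_Restr)
      ultimately show "\<exists>U. U \<in> sets (borel :: ((nat \<Rightarrow> nat) \<times> 'a) measure) \<and>
       (\<forall>D. borel_Pi euclidean (Restr r (underS r k)) D \<longrightarrow> (\<exists>w. D = {p. (w, p) \<in> U}))"
        using 1(1) by blast
    qed
    from bchoice[OF this] obtain U where
      U: "\<And>k. k \<in> Field r \<Longrightarrow> U k \<in> sets (borel :: ((nat \<Rightarrow> nat) \<times> 'a) measure)"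
        "\<And>k D. k \<in> Field r \<Longrightarrow> borel_Pi euclidean (Restr r (underS r k)) D \<Longrightarrow> \<exists>w. D = {p. (w, p) \<in> U k}"
      by blast
    define tail where "tail n w = (\<lambda>k. w (prod_encode (n, Suc k)))" for n and w :: "nat \<Rightarrow> nat"
    \<comment> \<open>The sections of \<open>V\<close> include all countable unions of sets of lower
      levels, and its complement is the universal set sought. It is Borel because
      \<open>Field r\<close> is countable.\<close>
    define V where "V = (\<Union>n. \<Union>k\<in>Field r. {q :: (nat \<Rightarrow> nat) \<times> 'a. fst q (prod_encode (n, 0)) = k} \<inter>
       (\<lambda>q. (tail n (fst q), snd q)) -` U k)"
    have coord: "continuous_on UNIV (\<lambda>q :: (nat \<Rightarrow> nat) \<times> 'a. fst q m)" for m
      by (rule continuous_on_compose2[OF continuous_on_product_coordinates continuous_on_fst[OF continuous_on_id]]) simp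
    have "(\<lambda>q :: (nat \<Rightarrow> nat) \<times> 'a. (tail n (fst q), snd q)) \<in> borel_measurable borel" for n
      unfolding tail_def
      by (intro borel_measurable_continuous_onI continuous_on_Pair continuous_on_coordinatewise_then_product
          coord continuous_on_snd[OF continuous_on_id])
    from measurable_sets[OF this U(1)]
    have "(\<lambda>q :: (nat \<Rightarrow> nat) \<times> 'a. (tail n (fst q), snd q)) -` U k \<in> sets borel" if "k \<in> Field r" for n k
      using that by simp
    moreover have "{q :: (nat \<Rightarrow> nat) \<times> 'a. fst q m = k} \<in> sets borel" for m k
    proof -
      have "{q :: (nat \<Rightarrow> nat) \<times> 'a. fst q m = k} = (\<lambda>q. fst q m) -` {k}"
        by auto
      also have "open \<dots>"
        by (intro open_vimage coord open_discrete)
      finally show ?thesis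
        by (rule borel_open)
    qed
    ultimately have "V \<in> sets borel"
      unfolding V_def by (intro sets.countable_UN' sets.Int) auto
    then have "- V \<in> sets borel"
      by (simp add: borel_comp)
    moreover have "\<exists>w. D = {p. (w, p) \<in> - V}" if D: "borel_Pi euclidean r D" for D
      using D
    proof (cases rule: borel_Pi.cases)
      case (step x E)
      have "\<forall>n. \<exists>w. E n = {p. (w, p) \<in> U (x n)}"
        using step U(2) by blast
      from choice[OF this] obtain v where v: "\<And>n. E n = {p. (v n, p) \<in> U (x n)}"
        by blast
      define w where "w m = (case prod_decode m of (n, 0) \<Rightarrow> x n | (n, Suc k) \<Rightarrow> v n k)" for m
      have "w (prod_encode (n, 0)) = x n" "tail n w = v n" for n
        unfolding w_def tail_def by auto
      then have "(w, p) \<in> V \<longleftrightarrow> (\<exists>n. p \<in> E n)" for p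
        unfolding V_def v using step by auto
      then have "D = {p. (w, p) \<in> - V}"
        using step by auto
      then show ?thesis
        by blast
    qed (use False in auto)
    ultimately show ?thesis
      by blast
  qed
qed

section \<open>A Cantor set without additive coincidences\<close>

text \<open>A branch is stored as the set of its finite prefixes, so that arbitrarily long prefixes
  found in one of two such sets identify the branch.\<close>

definition prefix_codes :: "(nat \<Rightarrow> nat) \<Rightarrow> nat set" where
  "prefix_codes w = range (\<lambda>n. to_nat (map w [0..<n]))"

text \<open>The number whose base four digits, all 0 or 1, mark the prefixes of \<open>w\<close>.
  The range is a Sidon set: a sum of two elements determines the summands.\<close>

definition sidon :: "(nat \<Rightarrow> nat) \<Rightarrow> real" where
  "sidon w = (\<Sum>k. of_bool (k \<in> prefix_codes w) * (1/4)^k)"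

lemma prefix_in_prefix_codes_iff:
  "to_nat (map a [0..<n]) \<in> prefix_codes c \<longleftrightarrow> (\<forall>i<n. a i = c i)"
proof -
  have "to_nat (map a [0..<n]) = to_nat (map c [0..<m]) \<longleftrightarrow> m = n \<and> (\<forall>i<n. a i = c i)" for m
    by (auto simp: list_eq_iff_nth_eq)
  then show ?thesis
    unfolding prefix_codes_def by auto
qed

lemma summable_sidon: "summable (\<lambda>k. of_bool (k \<in> S) * (1/4 :: real)^k)"
  by (rule summable_comparison_test'[of "\<lambda>k. (1/4)^k"]) (auto simp: summable_geometric)

lemma sidon_bounds: "0 \<le> sidon w" "sidon w \<le> 2"
proof -
  show "0 \<le> sidon w"
    unfolding sidon_def by (intro suminf_nonneg summable_sidon) auto
  have "sidon w \<le> (\<Sum>k. (1/4)^k)"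
    unfolding sidon_def by (intro suminf_le summable_sidon summable_geometric) auto
  also have "\<dots> \<le> 2"
    by (subst suminf_geometric) auto
  finally show "sidon w \<le> 2" .
qed

text \<open>The partial sums converge uniformly, and each digit is locally constant.\<close>

lemma continuous_on_sidon: "continuous_on UNIV sidon"
proof -
  let ?t = "\<lambda>k w. of_bool (k \<in> prefix_codes w) * (1/4 :: real)^k"
  have "continuous_on UNIV (?t k)" for k
    unfolding continuous_on_open_vimage[OF open_UNIV] 
  proof (intro allI impI)
    fix B :: "real set" assume "open B"
    have "open {w. k \<in> prefix_codes w \<longleftrightarrow> b}" for b
    proof (subst open_subopen, intro ballI)
      fix z assume z: "z \<in> {w. k \<in> prefix_codes w \<longleftrightarrow> b}"
      \<comment> \<open>\<open>k\<close> codes a list of a single length \<open>n\<close>, so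
        whether it codes a prefix of \<open>w\<close> depends only on the first \<open>n\<close>
        entries of \<open>w\<close>.\<close>
      define n where "n = length (from_nat k :: nat list)"
      have codes: "k \<in> prefix_codes w \<longleftrightarrow> to_nat (map w [0..<n]) = k" for w
      proof
        assume "k \<in> prefix_codes w"
        then obtain m where "k = to_nat (map w [0..<m])"
          unfolding prefix_codes_def by auto
        then show "to_nat (map w [0..<n]) = k"
          unfolding n_def by simp
      qed (auto simp: prefix_codes_def)
      have "{w. \<forall>i<n. w i = z i} \<subseteq> {w. k \<in> prefix_codes w \<longleftrightarrow> b}"
      proof
        fix w assume "w \<in> {w. \<forall>i<n. w i = z i}"
        then have "map w [0..<n] = map z [0..<n]"
          by simp
        then show "w \<in> {w. k \<in> prefix_codes w \<longleftrightarrow> b}"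
          using z unfolding codes by (simp only: mem_Collect_eq)
      qed
      then show "\<exists>T. open T \<and> z \<in> T \<and> T \<subseteq> {w. k \<in> prefix_codes w \<longleftrightarrow> b}"
        using open_Baire_prefix[of n z] by (intro exI[of _ "{w. \<forall>i<n. w i = z i}"]) auto
    qed
    then have "open (\<Union>b\<in>{b. of_bool b * (1/4)^k \<in> B}. {w. k \<in> prefix_codes w \<longleftrightarrow> b})"
      by (intro open_UN ballI)
    also have "(\<Union>b\<in>{b. of_bool b * (1/4)^k \<in> B}. {w. k \<in> prefix_codes w \<longleftrightarrow> b}) = ?t k -` B \<inter> UNIV"
      by (intro set_eqI) (simp only: UN_iff mem_Collect_eq vimage_eq IntI Int_iff UNIV_I simp_thms bex_simps, blast)
    finally show "open (?t k -` B \<inter> UNIV)" .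
  qed
  then have "\<forall>\<^sub>F n in sequentially. continuous_on UNIV (\<lambda>w. \<Sum>k<n. ?t k w)"
    by (intro always_eventually allI continuous_on_sum)
  moreover have "uniform_limit UNIV (\<lambda>n w. \<Sum>k<n. ?t k w) sidon sequentially"
    unfolding sidon_def[abs_def]
    by (rule Weierstrass_m_test[where M = "\<lambda>k. (1/4)^k"]) (auto simp: summable_geometric)
  ultimately show ?thesis
    by (rule uniform_limit_theorem) simp
qed

text \<open>Base four is large enough for sums of two digits from \<open>{0, 1}\<close> to be read off without carries.\<close>

lemma base4_digits_zero:
  fixes c :: "nat \<Rightarrow> int"
  assumes c: "\<And>k. \<bar>c k\<bar> \<le> 2" and sum: "(\<Sum>k. of_int (c k) * (1/4 :: real)^k) = 0"
  shows "c k = 0"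
proof (rule ccontr)
  assume "c k \<noteq> 0"
  \<comment> \<open>The first nonzero digit contributes at least (1/4)^m in absolute value, while
    all later ones together contribute at most 2/3 of that.\<close>
  define m where "m = (LEAST k. c k \<noteq> 0)"
  have m: "c m \<noteq> 0" "\<And>k. k < m \<Longrightarrow> c k = 0"
    unfolding m_def using LeastI[of "\<lambda>k. c k \<noteq> 0", OF \<open>c k \<noteq> 0\<close>] not_less_Least by blast+
  let ?t = "\<lambda>k. of_int (c k) * (1/4 :: real)^k"
  have le: "\<bar>?t k\<bar> \<le> 2 * (1/4)^k" for k
  proof -
    have "\<bar>real_of_int (c k)\<bar> \<le> 2"
      using c[of k] by linarith
    then show ?thesis
      by (simp add: abs_mult)
  qed
  have sg: "summable (\<lambda>k. 2 * (1/4 :: real)^k)"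
    by (intro summable_mult summable_geometric) simp
  have st: "summable ?t"
    by (rule summable_comparison_test'[OF sg, of 0]) (use le in simp)
  have "0 = (\<Sum>k. ?t (k + Suc m)) + (\<Sum>k<Suc m. ?t k)"
    using suminf_split_initial_segment[OF st, of "Suc m"] sum by simp
  also have "(\<Sum>k<Suc m. ?t k) = ?t m"
    using m(2) by simp
  finally have eq: "\<bar>?t m\<bar> = \<bar>\<Sum>k. ?t (k + Suc m)\<bar>"
    by simp
  have sg': "summable (\<lambda>k. 2 * (1/4 :: real)^(k + Suc m))"
    using summable_ignore_initial_segment[OF sg] .
  have "norm (\<Sum>k. ?t (k + Suc m)) \<le> (\<Sum>k. 2 * (1/4)^(k + Suc m))"
    by (rule norm_suminf_le[OF _ sg']) (simp only: real_norm_def le)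
  then have "\<bar>\<Sum>k. ?t (k + Suc m)\<bar> \<le> (\<Sum>k. 2 * (1/4)^(k + Suc m))"
    by (simp only: real_norm_def)
  also have "\<dots> = (\<Sum>k. (1/2 * (1/4)^m) * (1/4)^k)"
    by (intro suminf_cong) (simp add: power_add)
  also have "\<dots> = (1/2 * (1/4)^m) * (\<Sum>k. (1/4)^k)"
    by (intro suminf_mult summable_geometric) simp
  also have "\<dots> = 2/3 * (1/4)^m"
    by (subst suminf_geometric) auto
  also have "\<dots> < (1/4)^m"
    by simp
  also have "\<dots> \<le> \<bar>?t m\<bar>"
  proof -
    have "1 \<le> \<bar>real_of_int (c m)\<bar>"
      using m(1) by linarith
    then show ?thesis
      by (simp add: abs_mult)
  qed
  finally show False
    using eq by simp
qed

text \<open>All digits of the difference of the two sums vanish, so each prefix of \<open>a\<close>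
  is a prefix of \<open>c\<close> or of \<open>d\<close>. A prefix long enough to show a
  disagreement with both would be a contradiction.\<close>

lemma sidon_sum_eqD:
  assumes "sidon a + sidon b = sidon c + sidon d"
  shows "a = c \<or> a = d"
proof -
  let ?d = "\<lambda>k. of_bool (k \<in> prefix_codes a) + of_bool (k \<in> prefix_codes b)
    - of_bool (k \<in> prefix_codes c) - of_bool (k \<in> prefix_codes d) :: int"
  have "(\<Sum>k. of_int (?d k) * (1/4 :: real)^k) = sidon a + sidon b - sidon c - sidon d"
    unfolding sidon_def
    by (simp only: suminf_add suminf_diff summable_sidon summable_add summable_diff of_int_diff of_int_add of_int_of_bool
        left_diff_distrib distrib_right)
  then have d: "?d k = 0" for k
    using assms by (intro base4_digits_zero) auto
  have pre: "(\<forall>i<n. a i = c i) \<or> (\<forall>i<n. a i = d i)" for n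
  proof -
    define k where "k = to_nat (map a [0..<n])"
    have "k \<in> prefix_codes a"
      unfolding k_def prefix_codes_def by blast
    then have "k \<in> prefix_codes c \<or> k \<in> prefix_codes d"
      using d[of k] by (auto simp: of_bool_def split: if_splits)
    then show ?thesis
      unfolding k_def prefix_in_prefix_codes_iff .
  qed
  show ?thesis
  proof (rule ccontr)
    assume "\<not> (a = c \<or> a = d)"
    then obtain i j where "a i \<noteq> c i" "a j \<noteq> d j"
      by (auto simp: fun_eq_iff)
    then show False
      using pre[of "Suc (max i j)"] by (auto simp: less_Suc_eq_le)
  qed
qed

lemma inj_sidon: "inj sidon"
proof (rule injI)
  show "x = y" if "sidon x = sidon y" for x y
    using sidon_sum_eqD[of x x y y] that by simp
qed

section \<open>Borel rectangles, finer topologies on compact sets, and translation\<close>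

lemma Polish_space_Baire_space: "Polish_space Baire_space"
  unfolding Baire_space_def by (intro Polish_space_product_nat Polish_space_discrete_topology) simp

lemma Polish_space_Cantor_space: "Polish_space Cantor_space"
  unfolding Cantor_space_def by (intro Polish_space_product_nat Polish_space_discrete_topology) simp

lemma borel_sets_of_euclidean: "borel_sets_of euclidean = sets borel"
  unfolding borel_sets_of_def borel_def by simp

lemma sigma_algebra_borel_sets_of: "sigma_algebra (topspace X) (borel_sets_of X)"
  unfolding borel_sets_of_def by (rule sigma_algebra_sigma_sets) (auto dest: openin_subset)

lemma borel_sets_of_subset: "A \<in> borel_sets_of X \<Longrightarrow> A \<subseteq> topspace X"
  unfolding borel_sets_of_def by (rule sigma_sets_into_sp) (auto dest: openin_subset)

lemma borel_sets_of_preimage: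
  assumes f: "continuous_map X Y f" and B: "B \<in> borel_sets_of Y"
  shows "{x \<in> topspace X. f x \<in> B} \<in> borel_sets_of X"
  using B unfolding borel_sets_of_def[of Y]
proof (induction rule: sigma_sets.induct)
  case (Basic a)
  then show ?case
    using openin_continuous_map_preimage[OF f] unfolding borel_sets_of_def by (intro sigma_sets.Basic) simp
next
  case Empty
  then show ?case
    unfolding borel_sets_of_def by (simp add: sigma_sets.Empty)
next
  case (Compl a)
  have "{x \<in> topspace X. f x \<in> topspace Y - a} = topspace X - {x \<in> topspace X. f x \<in> a}"
    using continuous_map_image_subset_topspace[OF f] by auto
  then show ?case
    using Compl.IH unfolding borel_sets_of_def by (simp add: sigma_sets.Compl)
next
  case (Union a)
  have "{x \<in> topspace X. f x \<in> (\<Union>i. a i)} = (\<Union>i. {x \<in> topspace X. f x \<in> a i})"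
    by auto
  then show ?case
    using Union.IH unfolding borel_sets_of_def by (simp add: sigma_sets.Union)
qed

lemma borel_sets_of_Times:
  assumes "A \<in> borel_sets_of X" "B \<in> borel_sets_of Y"
  shows "A \<times> B \<in> borel_sets_of (prod_topology X Y)"
proof -
  interpret sigma_algebra "topspace (prod_topology X Y)" "borel_sets_of (prod_topology X Y)"
    by (rule sigma_algebra_borel_sets_of)
  have "A \<subseteq> topspace X" "B \<subseteq> topspace Y"
    by (intro borel_sets_of_subset assms)+
  then have "A \<times> B = {p \<in> topspace (prod_topology X Y). fst p \<in> A} \<inter> {p \<in> topspace (prod_topology X Y). snd p \<in> B}"
    by auto
  then show ?thesis
    using Int[OF borel_sets_of_preimage[OF continuous_map_fst assms(1)]
        borel_sets_of_preimage[OF continuous_map_snd assms(2)]] by simp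
qed

text \<open>Each side becomes clopen in a finer Polish topology on its own factor, so the rectangle
  is clopen in the product and belongs to every class.\<close>

lemma pot_Pi0_Times:
  assumes r: "Well_order r" and X: "Polish_space X" and Y: "Polish_space Y"
    and A: "A \<in> borel_sets_of X" and B: "B \<in> borel_sets_of Y"
  shows "pot_Pi0 X Y r (A \<times> B)"
proof -
  from borel_set_clopen_refinement[OF X A] obtain \<sigma> where \<sigma>: "Polish_space \<sigma>" "topspace \<sigma> = topspace X"
    "\<forall>W. openin X W \<longrightarrow> openin \<sigma> W" "openin \<sigma> A" "closedin \<sigma> A"
    by (elim exE conjE)
  from borel_set_clopen_refinement[OF Y B] obtain \<tau> where \<tau>: "Polish_space \<tau>" "topspace \<tau> = topspace Y"
    "\<forall>W. openin Y W \<longrightarrow> openin \<tau> W" "openin \<tau> B" "closedin \<tau> B"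
    by (elim exE conjE)
  have "borel_Pi (prod_topology \<sigma> \<tau>) r (A \<times> B)"
    using r \<sigma> \<tau> by (intro borel_Pi_clopen) (simp_all add: closedin_prod_Times_iff openin_prod_Times_iff)
  then show ?thesis
    unfolding pot_Pi0_def using \<sigma> \<tau> borel_sets_of_Times[OF A B]
    by (intro conjI exI[of _ \<sigma>] exI[of _ \<tau>])
qed

text \<open>The identity is a continuous bijection from a compact space to a Hausdorff space, hence
  a homeomorphism.\<close>

lemma subtopology_compactin_finer:
  assumes "compactin \<tau> K" "topspace \<tau> = UNIV" "\<And>U. open U \<Longrightarrow> openin \<tau> U"
  shows "subtopology \<tau> K = subtopology (euclidean :: 'a::metric_space topology) K"
proof -
  have "continuous_map \<tau> euclidean id"
    using assms(2,3) topology_finer_continuous_id[of euclidean \<tau>] by simp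
  then have "homeomorphic_map (subtopology \<tau> K) (subtopology euclidean K) id"
    using assms(1,2)
    by (intro continuous_imp_homeomorphic_map)
      (auto simp: compact_space_subtopology Hausdorff_space_subtopology continuous_map_in_subtopology
        continuous_map_from_subtopology Hausdorff_space_euclidean)
  then show ?thesis
    by simp
qed

lemma emeasure_lborel_translate:
  assumes "E \<in> sets borel"
  shows "emeasure lborel ((+) (c :: real) -` E) = emeasure lborel E"
proof -
  have "emeasure lborel E = emeasure (distr lborel borel ((+) c)) E"
    by (simp add: lborel_distr_plus)
  also have "\<dots> = emeasure lborel ((+) c -` E)"
    using assms by (subst emeasure_distr) auto
  finally show ?thesis ..
qed

section \<open>A pair without potentially simple separating set\<close>

definition sidon_graph :: "(nat \<Rightarrow> nat) set \<Rightarrow> (real \<times> real) set" where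
  "sidon_graph P = {(x, sidon z + x) | x z. z \<in> P}"

text \<open>Diagonalisation: \<open>z\<close> is put into \<open>P\<close> when the section of the universal set with code \<open>z\<close> covers less than half
  of the segment \<open>{0..1} \<times> \<real>\<close> of the line with parameter \<open>z\<close>. The compact sets \<open>K\<close> and \<open>L\<close> below miss at most a quarter
  of each such segment, so the alternative survives the passage from \<open>D\<close> to the set \<open>D'\<close> with a code.\<close>

lemma sidon_graph_not_pot_Pi0_separable:
  assumes r: "Well_order r"
  obtains P where "P \<in> sets borel"
    "\<And>D. pot_Pi0 euclideanreal euclideanreal r D \<Longrightarrow> sidon_graph P \<subseteq> D \<Longrightarrow> D \<inter> sidon_graph (- P) \<noteq> {}"
proof -
  obtain U where U: "U \<in> sets (borel :: ((nat \<Rightarrow> nat) \<times> real \<times> real) measure)"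
    "\<And>D. borel_Pi euclidean r D \<Longrightarrow> \<exists>w. D = {p. (w, p) \<in> U}"
    using borel_Pi_universal[OF r, where 'a = "real \<times> real"] by blast
  \<comment> \<open>The diagonal substitution: the first component serves both as a code for
    \<open>U\<close> and as the parameter of a line, on which the second component is the
    abscissa.\<close>
  let ?g = "\<lambda>q. (fst q, snd q, sidon (fst q) + snd q)"
  have "?g \<in> borel_measurable borel"
    by (intro borel_measurable_continuous_onI continuous_intros continuous_on_compose2[OF continuous_on_sidon]) auto
  from measurable_sets[OF this U(1)] have V: "?g -` U \<in> sets borel"
    by simp
  define Q where "Q = ?g -` U \<inter> UNIV \<times> {0..1}"
  have "UNIV \<times> {0..1 :: real} \<in> sets (borel :: ((nat \<Rightarrow> nat) \<times> real) measure)"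
    by (intro borel_closed closed_Times) auto
  then have Q: "Q \<in> sets borel"
    unfolding Q_def using V by simp
  then have "Q \<in> sets (borel \<Otimes>\<^sub>M lborel)"
    using sets_pair_measure_cong[OF refl sets_lborel] borel_prod by metis
  then have m: "(\<lambda>z. emeasure lborel (Pair z -` Q)) \<in> borel_measurable borel"
    by (rule lborel.measurable_emeasure_Pair)
  define P where "P = {z. emeasure lborel (Pair z -` Q) < ennreal (1/2)}"
  have "P = (\<lambda>z. emeasure lborel (Pair z -` Q)) -` {..<ennreal (1/2)} \<inter> space borel"
    unfolding P_def by auto
  also have "\<dots> \<in> sets borel"
    by (rule measurable_sets[OF m]) simp
  finally have PB: "P \<in> sets borel" .
  have "D \<inter> sidon_graph (- P) \<noteq> {}"
    if D: "pot_Pi0 euclideanreal euclideanreal r D" and AD: "sidon_graph P \<subseteq> D" for D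
  proof
    assume BD: "D \<inter> sidon_graph (- P) = {}"
    obtain \<sigma> \<tau> where \<sigma>: "Polish_space \<sigma>" "topspace \<sigma> = UNIV" "\<And>W. open W \<Longrightarrow> openin \<sigma> W"
      and \<tau>: "Polish_space \<tau>" "topspace \<tau> = UNIV" "\<And>W. open W \<Longrightarrow> openin \<tau> W"
      and DP: "borel_Pi (prod_topology \<sigma> \<tau>) r D"
      using D unfolding pot_Pi0_def by auto
    obtain K where K: "compactin \<sigma> K" "compact K" "K \<subseteq> {0..1}" "measure lborel ({0..1} - K) < 1/8"
      using compactin_inner_approx[OF \<sigma>, of 0 1 "1/8"] by auto
    \<comment> \<open>Since \<open>sidon\<close> takes values between 0 and 2, the segment over the
      unit interval has ordinates between 0 and 3.\<close>
    obtain L where L: "compactin \<tau> L" "compact L" "L \<subseteq> {0..3}" "measure lborel ({0..3} - L) < 1/8"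
      using compactin_inner_approx[OF \<tau>, of 0 3 "1/8"] by auto
    have "subtopology (prod_topology \<sigma> \<tau>) (K \<times> L) = subtopology euclidean (K \<times> L)"
      using subtopology_compactin_finer[OF K(1) \<sigma>(2,3)] subtopology_compactin_finer[OF L(1) \<tau>(2,3)]
      by (simp add: subtopology_Times)
    then obtain D' where D': "borel_Pi euclidean r D'" "D' \<inter> K \<times> L = D \<inter> K \<times> L"
      using borel_Pi_transfer[OF DP] by blast
    then obtain w where w: "D' = {p. (w, p) \<in> U}"
      using U(2) by blast
    define s where "s = sidon w"
    have s: "0 \<le> s" "s \<le> 2"
      unfolding s_def using sidon_bounds by auto
    \<comment> \<open>The abscissae at which the line with parameter \<open>w\<close> leaves
      \<open>K \<times> L\<close>; off \<open>N\<close> the sets \<open>D\<close> and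
      \<open>D'\<close> agree on that line.\<close>
    define N where "N = ({0..1} - K) \<union> ((+) s -` ({0..3} - L))"
    have KB: "K \<in> sets borel" and LB: "L \<in> sets borel"
      using K(2) L(2) by (auto intro: borel_compact)
    have LB': "(+) s -` ({0..3} - L) \<in> sets borel"
      using measurable_sets[of "(+) s" borel borel "{0..3} - L"] LB by simp
    have NB: "N \<in> sets borel"
      unfolding N_def using KB LB' by simp
    have "emeasure lborel ({0..1} - K) \<le> ennreal (1/8)" "emeasure lborel ({0..3} - L) \<le> ennreal (1/8)"
      using K(4) L(4) emeasure_bounded_finite[of "{0..1} - K"] emeasure_bounded_finite[of "{0..3} - L"]
      by (simp_all add: emeasure_eq_ennreal_measure bounded_diff ennreal_leI)
    then have "emeasure lborel N \<le> ennreal (1/8) + ennreal (1/8)"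
      unfolding N_def using KB LB LB'
      by (intro order_trans[OF emeasure_subadditive] add_mono) (auto simp: emeasure_lborel_translate)
    also have "\<dots> = ennreal (1/4)"
      by (subst ennreal_plus[symmetric]) auto
    finally have N: "emeasure lborel N \<le> ennreal (1/4)" .
    have good: "(x, s + x) \<in> K \<times> L" if "x \<in> {0..1} - N" for x
      using that s unfolding N_def by auto
    have Qw: "x \<in> Pair w -` Q \<longleftrightarrow> x \<in> {0..1} \<and> (x, s + x) \<in> D'" for x
      unfolding Q_def w s_def by auto
    have DD': "(x, s + x) \<in> D' \<longleftrightarrow> (x, s + x) \<in> D" if "x \<in> {0..1} - N" for x
      using good[OF that] D'(2) by blast
    have QB: "Pair w -` Q \<in> sets borel"
      using measurable_sets[of "Pair w" borel borel Q] Q by (simp add: borel_measurable_continuous_onI continuous_on_Pair)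
    show False
    \<comment> \<open>If \<open>w\<close> lies in \<open>P\<close>, its line lies in
      \<open>D\<close>, so the section and \<open>N\<close> cover an interval of length 1 with total
      measure at most 3/4. Otherwise the line misses \<open>D\<close>, so the section lies in
      \<open>N\<close> although its measure is at least 1/2.\<close>
    proof (cases "w \<in> P")
      case True
      have "{0..1} \<subseteq> Pair w -` Q \<union> N"
      proof
        fix x :: real assume "x \<in> {0..1}"
        moreover have "(x, s + x) \<in> D"
          using AD True unfolding sidon_graph_def s_def by blast
        ultimately show "x \<in> Pair w -` Q \<union> N"
          using DD'[of x] Qw[of x] by blast
      qed
      then have "emeasure lborel {0..1 :: real} \<le> emeasure lborel (Pair w -` Q \<union> N)"
        using QB NB by (intro emeasure_mono) auto
      also have "\<dots> \<le> emeasure lborel (Pair w -` Q) + emeasure lborel N"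
        using QB NB by (intro emeasure_subadditive) auto
      also have "\<dots> \<le> ennreal (1/2) + ennreal (1/4)"
        using True N unfolding P_def by (intro add_mono) auto
      also have "\<dots> = ennreal (3/4)"
        by (subst ennreal_plus[symmetric]) auto
      finally have "ennreal 1 \<le> ennreal (3/4)"
        by simp
      then show False
        by (subst (asm) ennreal_le_iff) auto
    next
      case False
      have "Pair w -` Q \<subseteq> N"
      proof
        fix x assume x: "x \<in> Pair w -` Q"
        have "(x, s + x) \<notin> D"
          using BD False unfolding sidon_graph_def s_def by blast
        then show "x \<in> N"
          using x DD'[of x] Qw[of x] by blast
      qed
      then have "emeasure lborel (Pair w -` Q) \<le> ennreal (1/4)"
        using N NB emeasure_mono[of "Pair w -` Q" N lborel] by simp
      then have "ennreal (1/2) \<le> ennreal (1/4)"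
        using False unfolding P_def by simp
      then show False
        by (subst (asm) ennreal_le_iff) auto
    qed
  qed
  then show thesis
    using that PB by blast
qed

section \<open>Properties of the union of lines\<close>

text \<open>The set is a continuous image of the Borel set \<open>P \<times> UNIV\<close>.\<close>

lemma analytic_in_sidon_graph:
  assumes "P \<in> sets borel"
  shows "analytic_in euclidean (sidon_graph P)"
proof -
  have "P \<times> UNIV \<in> borel_sets_of (euclidean :: ((nat \<Rightarrow> nat) \<times> real) topology)"
    using borel_sets_of_Times[of P euclidean UNIV euclidean] assms by (simp add: borel_sets_of_euclidean)
  moreover have "Polish_space (euclidean :: ((nat \<Rightarrow> nat) \<times> real) topology)"
    using Polish_space_prod_topology[OF Polish_space_Baire_space Polish_space_euclidean[where 'a = real]]
    by (simp add: Baire_space_eq_euclidean)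
  ultimately have "analytic_in (euclidean :: ((nat \<Rightarrow> nat) \<times> real) topology) (P \<times> UNIV)"
    using borel_imp_analytic_in by blast
  moreover have "continuous_map euclidean euclidean (\<lambda>q. (snd q, sidon (fst q) + snd q))"
    unfolding continuous_map_iff_continuous2
    by (intro continuous_intros continuous_on_compose2[OF continuous_on_sidon]) auto
  ultimately have "analytic_in euclidean ((\<lambda>q. (snd q, sidon (fst q) + snd q)) ` (P \<times> UNIV))"
    by (rule analytic_in_continuous_image)
  moreover have "(\<lambda>q. (snd q, sidon (fst q) + snd q)) ` (P \<times> UNIV) = sidon_graph P"
    unfolding sidon_graph_def by force
  ultimately show ?thesis
    by simp
qed

lemma sidon_graph_disjoint: "sidon_graph P \<inter> sidon_graph (- P) = {}"
  unfolding sidon_graph_def by (auto simp: inj_eq[OF inj_sidon])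

lemma sidon_graph_mono: "P \<subseteq> Q \<Longrightarrow> sidon_graph P \<subseteq> sidon_graph Q"
  unfolding sidon_graph_def by blast

text \<open>The two pairs of opposite corners of a rectangle give parameters with equal
  \<open>sidon\<close> sums. If two adjacent corners lie on the same line, they coincide, as the
  line has slope one.\<close>

lemma rectangle_in_sidon_graph:
  assumes uv: "\<And>x y. (u x, v y) \<in> sidon_graph UNIV"
  shows "(\<forall>x x'. u x = u x') \<or> (\<forall>y y'. v y = v y')"
proof (rule ccontr)
  assume "\<not> ?thesis"
  then obtain x x' y y' where ne: "u x \<noteq> u x'" "v y \<noteq> v y'"
    by blast
  have "\<exists>z. v y = sidon z + u x" for x y
    using uv[of x y] unfolding sidon_graph_def by auto
  then obtain z1 z2 z3 z4 where z: "v y = sidon z1 + u x" "v y' = sidon z2 + u x'"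
    "v y' = sidon z3 + u x" "v y = sidon z4 + u x'"
    by meson
  then have "sidon z1 + sidon z2 = sidon z3 + sidon z4"
    by linarith
  then have "z1 = z3 \<or> z1 = z4"
    by (rule sidon_sum_eqD)
  then show False
    using z ne by auto
qed

section \<open>A copy of the Cantor space in the real line\<close>

lemma compact_UNIV_Cantor: "compact (UNIV :: (nat \<Rightarrow> bool) set)"
proof -
  have "compactin (product_topology (\<lambda>i::nat. euclidean :: bool topology) UNIV) (\<Pi>\<^sub>E i\<in>UNIV. UNIV)"
    by (subst compactin_PiE) (auto intro: finite_imp_compact)
  then show ?thesis
    by (simp add: euclidean_product_topology)
qed

text \<open>An embedding into the reals is needed because the spaces in the theorem have real
  points; \<open>sidon\<close> already provides an injective continuous map.\<close>

definition cantor_to_real :: "(nat \<Rightarrow> bool) \<Rightarrow> real" where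
  "cantor_to_real x = sidon (\<lambda>n. of_bool (x n))"

lemma inj_cantor_to_real: "inj cantor_to_real"
proof (rule injI)
  fix x y assume "cantor_to_real x = cantor_to_real y"
  then have "(\<lambda>n. of_bool (x n) :: nat) = (\<lambda>n. of_bool (y n))"
    unfolding cantor_to_real_def by (rule injD[OF inj_sidon])
  then show "x = y"
    by (auto simp: fun_eq_iff of_bool_eq_iff)
qed

lemma continuous_on_cantor_to_real: "continuous_on UNIV cantor_to_real"
  unfolding cantor_to_real_def
proof (rule continuous_on_compose2[OF continuous_on_sidon])
  have "continuous_on UNIV (\<lambda>x :: nat \<Rightarrow> bool. of_bool (x n) :: nat)" for n
    by (rule continuous_on_compose2[OF _ continuous_on_product_coordinates, where t = UNIV])
      (auto simp: continuous_on_open_vimage open_discrete)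
  then show "continuous_on UNIV (\<lambda>x :: nat \<Rightarrow> bool. \<lambda>n. of_bool (x n) :: nat)"
    by (rule continuous_on_coordinatewise_then_product)
qed simp

text \<open>Only spaces with real points are tested, which makes the property of \<open>S\<close>
  weaker and its refutation stronger. The inequality of the two truth values expresses that exactly
  one alternative holds.\<close>

theorem theorem1p13:
  fixes r :: "nat rel"
  assumes "Well_order r"
  shows "\<not> (\<exists>S. S \<in> borel_sets_of (prod_topology Cantor_space Cantor_space) \<and>
     (\<forall>(X::real topology) (Y::real topology) A B.
        Polish_space X \<and> Polish_space Y \<and>
        analytic_in (prod_topology X Y) A \<and> analytic_in (prod_topology X Y) B \<and> A \<inter> B = {}
        \<longrightarrow>
        ((\<exists>D. pot_Pi0 X Y r D \<and> A \<subseteq> D \<and> D \<inter> B = {})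
         \<noteq>
         (\<exists>u v. continuous_map Cantor_space X u \<and> continuous_map Cantor_space Y v \<and>
            S \<subseteq> {p. (u (fst p), v (snd p)) \<in> A} \<and>
            UNIV - S \<subseteq> {p. (u (fst p), v (snd p)) \<in> B}))))"
proof (rule notI, elim exE conjE)
  fix S
  define sep where "sep X Y A B \<longleftrightarrow> (\<exists>D. pot_Pi0 X Y r D \<and> A \<subseteq> D \<and> D \<inter> B = {})"
    for X Y :: "real topology" and A B
  define red where "red X Y A B \<longleftrightarrow> (\<exists>u v. continuous_map Cantor_space X u \<and> continuous_map Cantor_space Y v \<and>
      S \<subseteq> {p. (u (fst p), v (snd p)) \<in> A} \<and> UNIV - S \<subseteq> {p. (u (fst p), v (snd p)) \<in> B})"
    for X Y :: "real topology" and A B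
  assume S: "S \<in> borel_sets_of (prod_topology Cantor_space Cantor_space)"
    and "\<forall>(X::real topology) (Y::real topology) A B.
        Polish_space X \<and> Polish_space Y \<and>
        analytic_in (prod_topology X Y) A \<and> analytic_in (prod_topology X Y) B \<and> A \<inter> B = {}
        \<longrightarrow>
        ((\<exists>D. pot_Pi0 X Y r D \<and> A \<subseteq> D \<and> D \<inter> B = {})
         \<noteq>
         (\<exists>u v. continuous_map Cantor_space X u \<and> continuous_map Cantor_space Y v \<and>
            S \<subseteq> {p. (u (fst p), v (snd p)) \<in> A} \<and>
            UNIV - S \<subseteq> {p. (u (fst p), v (snd p)) \<in> B}))"
  from this(2)[folded sep_def red_def, rule_format]
  have dichotomy: "sep X Y A B \<noteq> red X Y A B"
    if "Polish_space X" "Polish_space Y" "analytic_in (prod_topology X Y) A" "analytic_in (prod_topology X Y) B"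
      "A \<inter> B = {}" for X Y :: "real topology" and A B
    using that by (intro notI) simp
  let ?C = "prod_topology Cantor_space Cantor_space"
  have topC: "topspace Cantor_space = UNIV"
    by (simp add: Cantor_space_eq_euclidean)
  obtain P where P: "P \<in> sets borel"
    "\<And>D. pot_Pi0 euclideanreal euclideanreal r D \<Longrightarrow> sidon_graph P \<subseteq> D \<Longrightarrow> D \<inter> sidon_graph (- P) \<noteq> {}"
    using sidon_graph_not_pot_Pi0_separable[OF assms] by blast
  have "\<not> sep euclideanreal euclideanreal (sidon_graph P) (sidon_graph (- P))"
    using P(2) unfolding sep_def by blast
  moreover have "- P \<in> sets borel"
    using P(1) by (rule borel_comp)
  ultimately have "red euclideanreal euclideanreal (sidon_graph P) (sidon_graph (- P))"
    using dichotomy[of euclideanreal euclideanreal "sidon_graph P" "sidon_graph (- P)"]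
      analytic_in_sidon_graph[OF P(1)] analytic_in_sidon_graph[of "- P"] sidon_graph_disjoint[of P]
      Polish_space_euclidean[where 'a = real] by simp
  then obtain u v where uv: "S \<subseteq> {p. (u (fst p), v (snd p)) \<in> sidon_graph P}"
      "UNIV - S \<subseteq> {p. (u (fst p), v (snd p)) \<in> sidon_graph (- P)}"
    unfolding red_def by (elim exE conjE)
  have Sx: "(x, y) \<in> S \<longleftrightarrow> (u x, v y) \<in> sidon_graph P" for x y
  proof (cases "(x, y) \<in> S")
    case True
    then show ?thesis
      using uv(1) by auto
  next
    case False
    then have "(u x, v y) \<in> sidon_graph (- P)"
      using uv(2) by auto
    then show ?thesis
      using False sidon_graph_disjoint[of P] by blast
  qed
  have "(u x, v y) \<in> sidon_graph UNIV" for x y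
  proof -
    have "(u x, v y) \<in> sidon_graph P \<or> (u x, v y) \<in> sidon_graph (- P)"
      using subsetD[OF uv(1), of "(x, y)"] subsetD[OF uv(2), of "(x, y)"] by auto
    then show ?thesis
      using sidon_graph_mono[of P UNIV] sidon_graph_mono[of "- P" UNIV] by blast
  qed
  then have const: "(\<forall>x x'. u x = u x') \<or> (\<forall>y y'. v y = v y')"
    by (rule rectangle_in_sidon_graph)
  \<comment> \<open>An arbitrary point at which the sections of \<open>S\<close> are taken.\<close>
  let ?a = "undefined :: nat \<Rightarrow> bool"
  have sections: "{y. (?a, y) \<in> S} \<in> borel_sets_of Cantor_space" "{x. (x, ?a) \<in> S} \<in> borel_sets_of Cantor_space"
    using borel_sets_of_preimage[OF _ S, of Cantor_space "\<lambda>y. (?a, y)"]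
      borel_sets_of_preimage[OF _ S, of Cantor_space "\<lambda>x. (x, ?a)"]
    by (simp_all add: continuous_map_pairwise comp_def topC)
  have UB: "UNIV \<in> borel_sets_of Cantor_space"
    using borel_sets_of_preimage[OF continuous_map_id, of UNIV Cantor_space]
    by (simp add: Cantor_space_eq_euclidean borel_sets_of_euclidean)
  \<comment> \<open>If \<open>u\<close> or \<open>v\<close> is constant, membership in
    \<open>S\<close> does not depend on the corresponding coordinate.\<close>
  have "S = UNIV \<times> {y. (?a, y) \<in> S} \<or> S = {x. (x, ?a) \<in> S} \<times> UNIV"
    using const
  proof
    assume u: "\<forall>x x'. u x = u x'"
    have "(x, y) \<in> S \<longleftrightarrow> (?a, y) \<in> S" for x y
      unfolding Sx using u[rule_format, of x ?a] by simp
    then show ?thesis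
      by auto
  next
    assume v: "\<forall>y y'. v y = v y'"
    have "(x, y) \<in> S \<longleftrightarrow> (x, ?a) \<in> S" for x y
      unfolding Sx using v[rule_format, of y ?a] by simp
    then show ?thesis
      by auto
  qed
  then obtain C1 C2 where C: "S = C1 \<times> C2" "C1 \<in> borel_sets_of Cantor_space" "C2 \<in> borel_sets_of Cantor_space"
    using sections UB by blast
  let ?h = cantor_to_real
  let ?X = "top_of_set (range ?h)"
  let ?hh = "\<lambda>p. (?h (fst p), ?h (snd p))"
  have X: "Polish_space ?X"
    using compact_continuous_image[OF continuous_on_cantor_to_real compact_UNIV_Cantor] compact_imp_closed
    by (intro Polish_space_closedin Polish_space_euclidean) auto
  have h: "continuous_map Cantor_space ?X ?h"
    using continuous_on_cantor_to_real
    by (auto simp: Cantor_space_eq_euclidean continuous_map_in_subtopology)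
  \<comment> \<open>Compactness makes the inverse continuous, so \<open>?h\<close> carries Borel
    sets to Borel sets of its range.\<close>
  have "continuous_map ?X Cantor_space (inv ?h)"
    using continuous_on_inv[OF continuous_on_cantor_to_real compact_UNIV_Cantor, of "inv ?h"] inj_cantor_to_real
    by (simp add: Cantor_space_eq_euclidean)
  then have hB: "?h ` C \<in> borel_sets_of ?X" if "C \<in> borel_sets_of Cantor_space" for C
  proof -
    have "?h ` C = {t \<in> topspace ?X. inv ?h t \<in> C}"
      using inj_cantor_to_real by auto
    then show ?thesis
      using borel_sets_of_preimage[OF \<open>continuous_map ?X Cantor_space (inv ?h)\<close> that] by simp
  qed
  have disj: "?hh ` S \<inter> ?hh ` (UNIV - S) = {}"
    by (auto simp: inj_eq[OF inj_cantor_to_real])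
  have "pot_Pi0 ?X ?X r (?h ` C1 \<times> ?h ` C2)"
    using C by (intro pot_Pi0_Times assms X hB)
  moreover have "?h ` C1 \<times> ?h ` C2 = ?hh ` S"
    unfolding C(1) by force
  ultimately have "sep ?X ?X (?hh ` S) (?hh ` (UNIV - S))"
    unfolding sep_def using disj by (intro exI[of _ "?hh ` S"] conjI) auto
  \<comment> \<open>Both maps are \<open>?h\<close>, so the images of \<open>S\<close> and its
    complement satisfy the second alternative in addition to the first.\<close>
  moreover have "red ?X ?X (?hh ` S) (?hh ` (UNIV - S))"
    unfolding red_def using h by (intro exI[of _ ?h]) blast
  moreover have analytic: "analytic_in (prod_topology ?X ?X) (?hh ` T)" if "T \<in> borel_sets_of ?C" for T
  proof (rule analytic_in_continuous_image)
    show "analytic_in ?C T"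
      using that by (intro borel_imp_analytic_in Polish_space_prod_topology Polish_space_Cantor_space)
    have "continuous_map ?C ?X (?h \<circ> fst)" "continuous_map ?C ?X (?h \<circ> snd)"
      using h by (auto intro: continuous_map_compose continuous_map_fst continuous_map_snd)
    then show "continuous_map ?C (prod_topology ?X ?X) ?hh"
      unfolding continuous_map_pairwise by (simp add: comp_def)
  qed
  moreover have "UNIV - S \<in> borel_sets_of ?C"
    using sigma_sets.Compl[of S "topspace ?C"] S topC unfolding borel_sets_of_def by simp
  ultimately show False
    using dichotomy[OF X X analytic[OF S] analytic disj] by simp
qed

end
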